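(* Let $G:I\to I$ be the Gauss map. For $\alpha\in(0,1]$, there is an open subset $U$ of $C^{0,\alpha}(I)$ consisting of functions with the finite optimization property (with respect to $G$), such that $U$ is a dense subset of $\mathfrak{R}^\alpha(G)$.
   Context: $I=[0,1]$; the Gauss map $G:I\to I$ is $G(x)=\frac1x-\lfloor\frac1x\rfloor$ for $x\in(0,1]$ and $G(0)=0$. $C^{0,\alpha}(I)$ is the Banach space of real-valued $\alpha$-Hölder functions with norm $\|\psi\|_\infty+\sup_{x\ne y}|\psi(x)-\psi(y)|/|x-y|^\alpha$. $\mathcal{M}(I,G)$ is the set of $G$-invariant Borel probability measures on $I$, $\overline{\mathcal{M}(I,G)}$ its weak$^*$ closure, and $Q(G,\phi)=\sup_{\nu\in\mathcal{M}(I,G)}\int\phi\,d\nu$. A measure $\mu\in\overline{\mathcal{M}(I,G)}$ is $(G,\phi)$-limit-maximizing if $\int\phi\,d\mu=Q(G,\phi)$. A function $\phi\in C^{0,\alpha}(I)$ has the finite optimization property if there is a measure $\mu\in\overline{\mathcal{M}(I,G)}$ supported on finitely many points such that $\mu$ is the unique $(G,\phi)$-limit-maximizing measure. For $a_1,\dots,a_n\in\mathbb{N}=\{1,2,\dots\}$, $[a_1,\dots,a_n]$ denotes the finite continued fraction $1/(a_1+1/(\cdots+1/a_n))$. For $n\in\mathbb{N}$ and $\mathbf{a}=(a_1,\dots,a_n)\in\mathbb{N}^n$ put $p_0(\mathbf{a})=0$, $p_k(\mathbf{a})=[a_{n-k+1},\dots,a_n]$ for $1\le k\le n$; the finite-continued-fraction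 (FCF) measure is $\mu_{\mathbf{a}}=\frac{1}{n+1}\sum_{k=0}^n\delta_{p_k(\mathbf{a})}$. $\mathfrak{R}^\alpha(G)$ (rationally maximized functions) is the set of $\phi\in C^{0,\alpha}(I)$ such that either the Dirac measure $\delta_0$ or some FCF measure is $(G,\phi)$-limit-maximizing. *)

theory Defs
  imports "HOL-Probability.Probability"
begin

section \<open>The Gauss map and finite continued fractions\<close>

definition gauss_map :: "real \<Rightarrow> real" where
  "gauss_map x = (if x = 0 then 0 else 1 / x - of_int \<lfloor>1 / x\<rfloor>)"

text \<open>
  The empty list evaluates to \<open>0\<close>, which is the convention \<open>p\<^sub>0 = 0\<close>, and
  \<open>cont_frac [a] = 1 / a\<close>.
\<close>

fun cont_frac :: "nat list \<Rightarrow> real" where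
  "cont_frac [] = 0"
| "cont_frac (a # as) = 1 / (real a + cont_frac as)"

text \<open>The value \<open>[a\<^bsub>n-k+1\<^esub>, \<dots>, a\<^sub>n]\<close> of the last \<open>k\<close> of the \<open>n\<close> partial quotients.\<close>

definition fcf_point :: "nat list \<Rightarrow> nat \<Rightarrow> real" where
  "fcf_point as k = cont_frac (drop (length as - k) as)"


section \<open>Invariant measures\<close>

abbreviation unit_borel :: "real measure" where
  "unit_borel \<equiv> restrict_space borel {0..1}"

definition invariant_measures :: "real measure set" where
  "invariant_measures =
     {\<mu> \<in> space (prob_algebra unit_borel). distr \<mu> unit_borel gauss_map = \<mu>}"

text \<open>
  The weak* topology on the Borel probability measures on \<open>[0,1]\<close>: the coarsest one for which
  every \<open>\<mu> \<mapsto> \<integral> f d\<mu>\<close> with \<open>f\<close> continuous on \<open>[0,1]\<close> is continuous.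
\<close>

definition weak_star_topology :: "real measure topology" where
  "weak_star_topology = topology_generated_by
     {{\<mu> \<in> space (prob_algebra unit_borel). integral\<^sup>L \<mu> f \<in> V} | f V.
        continuous_on {0..1} (f :: real \<Rightarrow> real) \<and> open V}"

definition limit_measures :: "real measure set" where
  "limit_measures = weak_star_topology closure_of invariant_measures"

definition max_integral :: "(real \<Rightarrow> real) \<Rightarrow> real" where
  "max_integral \<phi> = (SUP \<nu>\<in>invariant_measures. integral\<^sup>L \<nu> \<phi>)"

definition limit_maximizing :: "(real \<Rightarrow> real) \<Rightarrow> real measure \<Rightarrow> bool" where
  "limit_maximizing \<phi> \<mu> \<longleftrightarrow> \<mu> \<in> limit_measures \<and> integral\<^sup>L \<mu> \<phi> = max_integral \<phi>"

definition finitely_supported :: "real measure \<Rightarrow> bool" where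
  "finitely_supported \<mu> \<longleftrightarrow> (\<exists>F. finite F \<and> F \<subseteq> {0..1} \<and> emeasure \<mu> ({0..1} - F) = 0)"

definition finite_optimization_property :: "(real \<Rightarrow> real) \<Rightarrow> bool" where
  "finite_optimization_property \<phi> \<longleftrightarrow>
     (\<exists>\<mu>\<in>limit_measures. finitely_supported \<mu> \<and> limit_maximizing \<phi> \<mu> \<and>
        (\<forall>\<nu>. limit_maximizing \<phi> \<nu> \<longrightarrow> \<nu> = \<mu>))"

definition fcf_measure :: "nat list \<Rightarrow> real measure" where
  "fcf_measure as = measure_of (space unit_borel) (sets unit_borel)
     (\<lambda>A. (\<Sum>k\<le>length as. emeasure (return unit_borel (fcf_point as k)) A) / of_nat (length as + 1))"


section \<open>Hoelder functions\<close>

text \<open>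
  A function on \<open>[0,1]\<close> is represented by its extensional extension to the reals, so that equality
  in \<open>holder_space \<alpha>\<close> is equality on \<open>[0,1]\<close>.
\<close>

definition holder_space :: "real \<Rightarrow> (real \<Rightarrow> real) set" where
  "holder_space \<alpha> = {\<phi> \<in> extensional {0..1}.
     \<exists>C. \<forall>x\<in>{0..1}. \<forall>y\<in>{0..1}. \<bar>\<phi> x - \<phi> y\<bar> \<le> C * \<bar>x - y\<bar> powr \<alpha>}"

definition holder_norm :: "real \<Rightarrow> (real \<Rightarrow> real) \<Rightarrow> real" where
  "holder_norm \<alpha> \<phi> = (SUP x\<in>{0..1}. \<bar>\<phi> x\<bar>) +
     (SUP (x, y)\<in>{(x, y). x \<in> {0..1} \<and> y \<in> {0..1} \<and> x \<noteq> y}. \<bar>\<phi> x - \<phi> y\<bar> / \<bar>x - y\<bar> powr \<alpha>)"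

text \<open>
  The guard is needed because \<^locale>\<open>Metric_space\<close> asks for nonnegativity and symmetry on the whole
  type, whereas the suprema are meaningful on \<open>holder_space \<alpha>\<close> only.
\<close>

definition holder_dist :: "real \<Rightarrow> (real \<Rightarrow> real) \<Rightarrow> (real \<Rightarrow> real) \<Rightarrow> real" where
  "holder_dist \<alpha> \<phi> \<psi> =
     (if \<phi> \<in> holder_space \<alpha> \<and> \<psi> \<in> holder_space \<alpha> then holder_norm \<alpha> (\<lambda>x. \<phi> x - \<psi> x) else 0)"

definition holder_topology :: "real \<Rightarrow> (real \<Rightarrow> real) topology" where
  "holder_topology \<alpha> = Metric_space.mtopology (holder_space \<alpha>) (holder_dist \<alpha>)"

definition rationally_maximized :: "real \<Rightarrow> (real \<Rightarrow> real) set" where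
  "rationally_maximized \<alpha> = {\<phi> \<in> holder_space \<alpha>.
     limit_maximizing \<phi> (return unit_borel 0) \<or>
     (\<exists>as. as \<noteq> [] \<and> (\<forall>a\<in>set as. 1 \<le> a) \<and> limit_maximizing \<phi> (fcf_measure as))}"


section \<open>Basic facts\<close>

lemma gauss_map_measurable: "gauss_map \<in> measurable unit_borel unit_borel"
proof -
  have "(\<lambda>x. if x = 0 then 0 else 1 / x - of_int \<lfloor>1 / x\<rfloor> :: real) \<in> borel_measurable borel"
    by measurable
  then have "gauss_map \<in> borel_measurable borel"
    by (simp only: gauss_map_def[abs_def])
  moreover have "0 \<le> gauss_map x \<and> gauss_map x \<le> 1" for x
    unfolding gauss_map_def by (simp; linarith)
  ultimately show ?thesis
    by (intro measurable_restrict_space1 measurable_restrict_space2) auto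
qed

lemma sets_fcf_measure: "sets (fcf_measure as) = sets unit_borel"
  unfolding fcf_measure_def by (rule sigma_algebra.sets_measure_of_eq[OF sets.sigma_algebra_axioms])

lemma emeasure_fcf_measure:
  assumes "A \<in> sets unit_borel"
  shows "emeasure (fcf_measure as) A =
    (\<Sum>k\<le>length as. indicator A (fcf_point as k)) / of_nat (length as + 1)"
proof -
  let ?m = "\<lambda>A. (\<Sum>k\<le>length as. emeasure (return unit_borel (fcf_point as k)) A) / of_nat (length as + 1)"
  have "countably_additive (sets unit_borel) ?m"
  proof (rule countably_additiveI)
    fix B :: "nat \<Rightarrow> real set"
    assume B: "range B \<subseteq> sets unit_borel" "disjoint_family B"
    have "(\<Sum>i. ?m (B i)) =
        (\<Sum>i. \<Sum>k\<le>length as. emeasure (return unit_borel (fcf_point as k)) (B i)) / of_nat (length as + 1)"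
      by (simp add: divide_ennreal_def)
    also have "(\<Sum>i. \<Sum>k\<le>length as. emeasure (return unit_borel (fcf_point as k)) (B i)) =
        (\<Sum>k\<le>length as. \<Sum>i. emeasure (return unit_borel (fcf_point as k)) (B i))"
      by (rule suminf_sum) simp
    also have "\<dots> = (\<Sum>k\<le>length as. emeasure (return unit_borel (fcf_point as k)) (\<Union>i. B i))"
      using B by (intro sum.cong suminf_emeasure) auto
    finally show "(\<Sum>i. ?m (B i)) = ?m (\<Union>i. B i)" .
  qed
  then have "emeasure (fcf_measure as) A = ?m A"
    using assms sets.space_closed[of unit_borel]
    by (intro emeasure_measure_of[OF fcf_measure_def])
       (simp_all add: sets_fcf_measure positive_def del: of_nat_add)
  then show ?thesis
    using assms by simp
qed

lemma return_0_invariant: "return unit_borel 0 \<in> invariant_measures"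
proof -
  have "0 \<in> space unit_borel"
    by (simp add: space_restrict_space)
  moreover have "distr (return unit_borel 0) unit_borel gauss_map = return unit_borel 0"
    using distr_return[OF gauss_map_measurable \<open>0 \<in> space unit_borel\<close>]
    by (simp add: gauss_map_def)
  ultimately show ?thesis
    by (simp add: invariant_measures_def space_prob_algebra prob_space_return)
qed

lemma topspace_weak_star: "topspace weak_star_topology = space (prob_algebra unit_borel)"
proof -
  have "{\<mu> \<in> space (prob_algebra unit_borel). integral\<^sup>L \<mu> (\<lambda>_. 0) \<in> UNIV} \<in>
      {{\<mu> \<in> space (prob_algebra unit_borel). integral\<^sup>L \<mu> f \<in> V} | f V.
        continuous_on {0..1} (f :: real \<Rightarrow> real) \<and> open V}"
    using open_UNIV continuous_on_const by blast
  then have "space (prob_algebra unit_borel) \<subseteq> topspace weak_star_topology"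
    unfolding weak_star_topology_def topology_generated_by_topspace by blast
  moreover have "topspace weak_star_topology \<subseteq> space (prob_algebra unit_borel)"
    unfolding weak_star_topology_def topology_generated_by_topspace by blast
  ultimately show ?thesis
    by (rule equalityI[rotated])
qed

lemma holder_bounded:
  assumes "\<phi> \<in> holder_space \<alpha>" "\<psi> \<in> holder_space \<alpha>" "0 < \<alpha>"
  shows "bdd_above ((\<lambda>x. \<bar>\<phi> x - \<psi> x\<bar>) ` {0..1})"
    and "bdd_above ((\<lambda>(x, y). \<bar>(\<phi> x - \<psi> x) - (\<phi> y - \<psi> y)\<bar> / \<bar>x - y\<bar> powr \<alpha>) `
           {(x, y). x \<in> {0..1} \<and> y \<in> {0..1} \<and> x \<noteq> y})"
proof -
  obtain C where C: "\<And>x y. x \<in> {0..1} \<Longrightarrow> y \<in> {0..1} \<Longrightarrow> \<bar>\<phi> x - \<phi> y\<bar> \<le> C * \<bar>x - y\<bar> powr \<alpha>"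
    using assms(1) unfolding holder_space_def by blast
  obtain D where D: "\<And>x y. x \<in> {0..1} \<Longrightarrow> y \<in> {0..1} \<Longrightarrow> \<bar>\<psi> x - \<psi> y\<bar> \<le> D * \<bar>x - y\<bar> powr \<alpha>"
    using assms(2) unfolding holder_space_def by blast
  have CD: "\<bar>(\<phi> x - \<psi> x) - (\<phi> y - \<psi> y)\<bar> \<le> (C + D) * \<bar>x - y\<bar> powr \<alpha>"
    if "x \<in> {0..1}" "y \<in> {0..1}" for x y
    using C[OF that] D[OF that] by (simp add: distrib_right)
  have "0 \<le> C + D"
    using CD[of 0 1] by simp
  have "\<bar>\<phi> x - \<psi> x\<bar> \<le> \<bar>\<phi> 0 - \<psi> 0\<bar> + (C + D)" if x: "x \<in> {0..1}" for x
  proof -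
    have "(C + D) * \<bar>x - 0\<bar> powr \<alpha> \<le> (C + D) * 1"
      using x \<open>0 \<le> C + D\<close> \<open>0 < \<alpha>\<close> by (intro mult_left_mono powr_le1) auto
    then show ?thesis
      using CD[OF x, of 0] by simp
  qed
  then show "bdd_above ((\<lambda>x. \<bar>\<phi> x - \<psi> x\<bar>) ` {0..1})"
    by (intro bdd_aboveI2)
  show "bdd_above ((\<lambda>(x, y). \<bar>(\<phi> x - \<psi> x) - (\<phi> y - \<psi> y)\<bar> / \<bar>x - y\<bar> powr \<alpha>) `
           {(x, y). x \<in> {0..1} \<and> y \<in> {0..1} \<and> x \<noteq> y})"
    using CD by (intro bdd_aboveI2[where M = "C + D"]) (auto simp: divide_le_eq)
qed

lemma Metric_space_holder:
  assumes "0 < \<alpha>"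
  shows "Metric_space (holder_space \<alpha>) (holder_dist \<alpha>)"
proof
  let ?I = "{0..1::real}"
  let ?P = "{(x, y). x \<in> ?I \<and> y \<in> ?I \<and> x \<noteq> y}"
  let ?s = "\<lambda>\<phi> \<psi>. SUP x\<in>?I. \<bar>\<phi> x - \<psi> x\<bar> :: real"
  let ?h = "\<lambda>\<phi> \<psi>. SUP (x, y)\<in>?P. \<bar>(\<phi> x - \<psi> x) - (\<phi> y - \<psi> y)\<bar> / \<bar>x - y\<bar> powr \<alpha> :: real"
  have ne: "?P \<noteq> {}"
  proof
    assume "?P = {}"
    moreover have "(0, 1) \<in> ?P"
      by simp
    ultimately show False
      by blast
  qed
  have dist: "holder_dist \<alpha> \<phi> \<psi> = ?s \<phi> \<psi> + ?h \<phi> \<psi>"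
    if "\<phi> \<in> holder_space \<alpha>" "\<psi> \<in> holder_space \<alpha>" for \<phi> \<psi>
    using that by (simp add: holder_dist_def holder_norm_def)
  have s: "\<bar>\<phi> x - \<psi> x\<bar> \<le> ?s \<phi> \<psi>"
    if "\<phi> \<in> holder_space \<alpha>" "\<psi> \<in> holder_space \<alpha>" "x \<in> ?I" for \<phi> \<psi> x
    using holder_bounded(1)[OF that(1,2) assms] that(3) by (rule cSUP_upper[rotated])
  have h: "\<bar>(\<phi> x - \<psi> x) - (\<phi> y - \<psi> y)\<bar> / \<bar>x - y\<bar> powr \<alpha> \<le> ?h \<phi> \<psi>"
    if "\<phi> \<in> holder_space \<alpha>" "\<psi> \<in> holder_space \<alpha>" "x \<in> ?I" "y \<in> ?I" "x \<noteq> y" for \<phi> \<psi> x y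
    using cSUP_upper[OF _ holder_bounded(2)[OF that(1,2) assms], of "(x, y)"] that(3-) by simp
  have s0: "0 \<le> ?s \<phi> \<psi>" and h0: "0 \<le> ?h \<phi> \<psi>"
    if "\<phi> \<in> holder_space \<alpha>" "\<psi> \<in> holder_space \<alpha>" for \<phi> \<psi>
  proof -
    show "0 \<le> ?s \<phi> \<psi>"
      by (rule order_trans[OF _ s[OF that, of 0]]) auto
    show "0 \<le> ?h \<phi> \<psi>"
      by (rule order_trans[OF _ h[OF that, of 0 1]]) auto
  qed
  show "0 \<le> holder_dist \<alpha> \<phi> \<psi>" for \<phi> \<psi>
  proof (cases "\<phi> \<in> holder_space \<alpha> \<and> \<psi> \<in> holder_space \<alpha>")
    case True
    then show ?thesis
      using s0[of \<phi> \<psi>] h0[of \<phi> \<psi>] dist[of \<phi> \<psi>] by linarith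
  qed (auto simp: holder_dist_def)
  show "holder_dist \<alpha> \<phi> \<psi> = holder_dist \<alpha> \<psi> \<phi>" for \<phi> \<psi>
  proof -
    have "\<bar>\<phi> x - \<psi> x\<bar> = \<bar>\<psi> x - \<phi> x\<bar>"
      and "\<bar>(\<phi> x - \<psi> x) - (\<phi> y - \<psi> y)\<bar> = \<bar>(\<psi> x - \<phi> x) - (\<psi> y - \<phi> y)\<bar>" for x y
      by linarith+
    then show ?thesis
      unfolding holder_dist_def holder_norm_def by presburger
  qed
  show "holder_dist \<alpha> \<phi> \<psi> = 0 \<longleftrightarrow> \<phi> = \<psi>"
    if "\<phi> \<in> holder_space \<alpha>" "\<psi> \<in> holder_space \<alpha>" for \<phi> \<psi>
  proof
    assume "holder_dist \<alpha> \<phi> \<psi> = 0"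
    then have "?s \<phi> \<psi> \<le> 0"
      using dist[OF that] h0[OF that] by linarith
    then have "\<phi> x = \<psi> x" if "x \<in> ?I" for x
      using s[OF \<open>\<phi> \<in> _\<close> \<open>\<psi> \<in> _\<close> that] by linarith
    then show "\<phi> = \<psi>"
      using that by (intro extensionalityI[of _ ?I]) (auto simp: holder_space_def)
  next
    assume "\<phi> = \<psi>"
    then show "holder_dist \<alpha> \<phi> \<psi> = 0"
      using that ne by (simp add: holder_dist_def holder_norm_def case_prod_unfold)
  qed
  show "holder_dist \<alpha> \<phi> \<xi> \<le> holder_dist \<alpha> \<phi> \<psi> + holder_dist \<alpha> \<psi> \<xi>"
    if m: "\<phi> \<in> holder_space \<alpha>" "\<psi> \<in> holder_space \<alpha>" "\<xi> \<in> holder_space \<alpha>" for \<phi> \<psi> \<xi>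
  proof -
    have "?s \<phi> \<xi> \<le> ?s \<phi> \<psi> + ?s \<psi> \<xi>"
    proof (rule cSUP_least)
      fix x assume "x \<in> ?I"
      then show "\<bar>\<phi> x - \<xi> x\<bar> \<le> ?s \<phi> \<psi> + ?s \<psi> \<xi>"
        using s[OF m(1,2)] s[OF m(2,3)] by (smt (verit))
    qed auto
    moreover have "?h \<phi> \<xi> \<le> ?h \<phi> \<psi> + ?h \<psi> \<xi>"
    proof (rule cSUP_least[OF ne])
      fix p assume "p \<in> ?P"
      then obtain x y where p: "p = (x, y)" "x \<in> ?I" "y \<in> ?I" "x \<noteq> y"
        by blast
      have "\<bar>(\<phi> x - \<xi> x) - (\<phi> y - \<xi> y)\<bar> / \<bar>x - y\<bar> powr \<alpha> \<le>
          (\<bar>(\<phi> x - \<psi> x) - (\<phi> y - \<psi> y)\<bar> + \<bar>(\<psi> x - \<xi> x) - (\<psi> y - \<xi> y)\<bar>) / \<bar>x - y\<bar> powr \<alpha>"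
        by (intro divide_right_mono) auto
      also have "\<dots> \<le> ?h \<phi> \<psi> + ?h \<psi> \<xi>"
        using h[OF m(1,2) p(2-)] h[OF m(2,3) p(2-)] by (simp add: add_divide_distrib)
      finally show "(case p of (x, y) \<Rightarrow>
          \<bar>(\<phi> x - \<xi> x) - (\<phi> y - \<xi> y)\<bar> / \<bar>x - y\<bar> powr \<alpha>) \<le> ?h \<phi> \<psi> + ?h \<psi> \<xi>"
        by (simp add: p)
    qed
    ultimately show ?thesis
      using dist[OF m(1,2)] dist[OF m(2,3)] dist[OF m(1,3)] by linarith
  qed
qed

end

theory Submission
  imports Defs
begin

text \<open>
  For every FCF measure \<open>\<mu>\<close> (the empty word gives \<open>\<delta>\<^sub>0\<close>) there is a Hoelder function \<open>g\<close> such that \<open>\<mu>\<close>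
  minimizes the integral of \<open>g + h\<close> among the invariant measures for every \<open>h\<close> of small norm. One
  takes \<open>g\<close> large away from the points \<open>p\<^sub>k\<close>, equal to \<open>0\<close> at \<open>p\<^sub>1, \<dots>, p\<^sub>n\<close> and to \<open>1\<close> at \<open>p\<^sub>0 = 0\<close>: an
  orbit that stays near the \<open>p\<^sub>k\<close> must come close to \<open>0\<close> at least once in every \<open>n + 1\<close> steps, and
  doing so only that often is optimal. This is certified by a coboundary \<open>v - v \<circ> G\<close> with \<open>v\<close> constant
  near each \<open>p\<^sub>k\<close>. If \<open>\<mu>\<close> is limit-maximizing for \<open>\<phi>\<close>, it therefore remains so for everything near
  \<open>\<phi> - \<epsilon> g\<close>. Let \<open>U\<close> be the set of functions around which some FCF measure is limit-maximizing on a
  whole ball. On \<open>U\<close> the maximizing measure is unique: perturbing by \<open>\<plusminus>t f\<close> shows that any other one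
  gives the same integral to every Hoelder function \<open>f\<close>.
\<close>

section \<open>Finite continued fractions and the Gauss map near their values\<close>

lemma fcf_point_0 [simp]: "fcf_point as 0 = 0"
  by (simp add: fcf_point_def)

text \<open>Indices count from the end of the word, so passing from \<open>k\<close> to
  \<open>Suc k\<close> prepends a digit. This is an inverse branch of the Gauss map: with 1
  identified with 0, \<open>gauss_map\<close> sends \<open>p\<^sub>k\<^sub>+\<^sub>1\<close> to
  \<open>p\<^sub>k\<close>.\<close>

lemma fcf_point_Suc:
  assumes "k < length as"
  shows "fcf_point as (Suc k) = 1 / (real (as ! (length as - Suc k)) + fcf_point as k)"
proof -
  have "drop (length as - Suc k) as = as ! (length as - Suc k) # drop (length as - k) as"
    using assms Cons_nth_drop_Suc[of "length as - Suc k" as] by (simp add: Suc_diff_Suc)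
  then show ?thesis
    by (simp add: fcf_point_def)
qed

lemma digit_ge_1:
  assumes "\<forall>a\<in>set as. 1 \<le> a" "k < length as"
  shows "1 \<le> as ! (length as - Suc k)"
  using assms by simp

lemma fcf_point_bounds:
  assumes "\<forall>a\<in>set as. 1 \<le> a" "k \<le> length as"
  shows "0 \<le> fcf_point as k" "fcf_point as k \<le> 1"
proof -
  have "0 \<le> fcf_point as k \<and> fcf_point as k \<le> 1"
    using assms(2)
  proof (induction k)
    case (Suc k)
    then show ?case
      using digit_ge_1[OF assms(1), of k] by (simp add: fcf_point_Suc)
  qed simp
  then show "0 \<le> fcf_point as k" "fcf_point as k \<le> 1"
    by auto
qed

lemma fcf_point_pos:
  assumes "\<forall>a\<in>set as. 1 \<le> a" "0 < k" "k \<le> length as"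
  shows "0 < fcf_point as k"
proof -
  obtain j where j: "k = Suc j"
    using assms(2) by (cases k) auto
  then have "1 \<le> real (as ! (length as - Suc j))" "0 \<le> fcf_point as j"
    using digit_ge_1[OF assms(1), of j] fcf_point_bounds(1)[OF assms(1), of j] assms(3) by auto
  then show ?thesis
    using j assms(3) by (simp add: fcf_point_Suc)
qed

text \<open>From the second point on, the denominator is a digit at least 1 plus a positive tail,
  hence exceeds 1.\<close>

lemma fcf_point_eq_1:
  assumes "\<forall>a\<in>set as. 1 \<le> a" "k \<le> length as" "fcf_point as k = 1"
  shows "k = 1"
proof (rule ccontr)
  assume "k \<noteq> 1"
  moreover have "k \<noteq> 0"
    using assms(3) by (metis fcf_point_0 zero_neq_one)
  ultimately obtain j where j: "k = Suc j" "0 < j"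
    by (cases k) auto
  then have "1 \<le> real (as ! (length as - Suc j))" "0 < fcf_point as j"
    using digit_ge_1[OF assms(1), of j] fcf_point_pos[OF assms(1), of j] assms(2) by auto
  then show False
    using j assms(2,3) by (simp add: fcf_point_Suc)
qed

text \<open>Induction on the smaller index. Equal points have equal denominators; if the digits
  agree, the tails coincide, and otherwise the digits differ by 1 and the tails are 0 and 1. That is
  the ambiguity \<open>1 / (b + 1 / 1) = 1 / (b + 1)\<close>. Here both expansions are read from the
  end of the same word, so the last digit would have to be both 1 and \<open>b + 1\<close>.\<close>

lemma fcf_point_inj:
  assumes "\<forall>a\<in>set as. 1 \<le> a"
  shows "inj_on (fcf_point as) {..length as}"
proof -
  have "fcf_point as j \<noteq> fcf_point as k" if "j < k" "k \<le> length as" for j k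
    using that
  proof (induction j arbitrary: k)
    case 0
    then show ?case
      using fcf_point_pos[OF assms, of k] by simp
  next
    case (Suc j)
    then obtain m where m: "k = Suc m" "j < m" "m < length as"
      by (cases k) auto
    define a where "a = as ! (length as - Suc j)"
    define b where "b = as ! (length as - Suc m)"
    have pj: "0 \<le> fcf_point as j" "fcf_point as j \<le> 1" and pm: "0 < fcf_point as m" "fcf_point as m \<le> 1"
      using fcf_point_bounds[OF assms, of j] fcf_point_bounds[OF assms, of m] 
        fcf_point_pos[OF assms, of m] m by auto
    have ab: "1 \<le> a" "1 \<le> b"
      using digit_ge_1[OF assms] m by (simp_all add: a_def b_def)
    show ?case
    proof
      assume "fcf_point as (Suc j) = fcf_point as k"
      then have eq: "real a + fcf_point as j = real b + fcf_point as m"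
        using m ab pj pm by (simp add: fcf_point_Suc flip: a_def b_def)
      have "fcf_point as j \<noteq> fcf_point as m"
        using Suc.IH[of m] m by simp
      then have "a \<noteq> b"
        using eq by auto
      moreover have "\<bar>real a - real b\<bar> \<le> 1"
        using eq pj pm by linarith
      ultimately consider "real a = real b + 1" | "real b = real a + 1"
        by linarith
      then show False
      proof cases
        case 1
        then have "fcf_point as j = 0" "fcf_point as m = 1"
          using eq pj pm by linarith+
        then have "m = 1" "j = 0"
          using fcf_point_eq_1[OF assms, of m] m by auto
        have "0 < length as"
          using m(3) by (rule le_less_trans[OF le0])
        then have "a = 1"
          using \<open>fcf_point as m = 1\<close> \<open>m = 1\<close> \<open>j = 0\<close> fcf_point_Suc[of 0 as] ab(1)
          by (simp add: a_def)
        then show False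
          using 1 ab by simp
      next
        case 2
        then show False
          using eq pj pm by linarith
      qed
    qed
  qed
  then show ?thesis
    by (intro linorder_inj_onI') auto
qed

text \<open>Modulo 1 the Gauss map is continuous away from 0; the last two alternatives are its jumps.\<close>

lemma gauss_map_near:
  fixes a :: nat and y e :: real
  assumes "1 \<le> a" "0 \<le> y" "y \<le> 1" "0 < e"
  shows "\<forall>\<^sub>F x in nhds (1 / (real a + y)).
    \<bar>gauss_map x - y\<bar> < e \<or> (y = 0 \<and> 1 / real a < x \<and> 1 - e < gauss_map x \<and> gauss_map x \<le> 1) \<or> (y = 1 \<and> 0 \<le> gauss_map x \<and> gauss_map x < e)"
proof -
  \<comment> \<open>Small enough that the interval of radius \<open>e'\<close> about
    \<open>y\<close> reaches below 0 only if \<open>y = 0\<close> and above 1 only if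
    \<open>y = 1\<close>. So \<open>t\<close> below can leave [0,1) only in these two cases.\<close>
  define e' where "e' = min (min e 1) (min (if y = 0 then 1 else y) (if y = 1 then 1 else 1 - y))"
  have e': "0 < e'" "e' \<le> e" "e' \<le> 1" "y = 0 \<or> e' \<le> y" "y = 1 \<or> e' \<le> 1 - y"
    using assms by (auto simp: e'_def)
  have pos: "0 < 1 / (real a + y)"
    using assms by (simp add: add_pos_nonneg)
  have "isCont (\<lambda>x. 1 / x) (1 / (real a + y))"
    using pos by (intro continuous_intros) auto
  then have "((\<lambda>x. 1 / x) \<longlongrightarrow> real a + y) (nhds (1 / (real a + y)))"
    unfolding isCont_def tendsto_at_iff_tendsto_nhds by simp
  then have "\<forall>\<^sub>F x in nhds (1 / (real a + y)). dist (1 / x) (real a + y) < e'"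
    using e' by (intro tendstoD) auto
  moreover have "\<forall>\<^sub>F x in nhds (1 / (real a + y)). 0 < x"
    using pos by (intro order_tendstoD(1)[OF filterlim_ident])
  ultimately show ?thesis
  proof eventually_elim
    case (elim x)
    define t where "t = 1 / x - real a"
    have t: "\<bar>t - y\<bar> < e'"
      using elim by (simp add: t_def dist_real_def algebra_simps)
    have g: "gauss_map x = frac t"
      using elim using floor_diff_of_int[of "1 / x" "int a"] by (simp add: gauss_map_def t_def frac_def)
    consider "0 \<le> t" "t < 1" | "t < 0" | "1 \<le> t"
      by linarith
    then show ?case
    proof cases
      case 1
      then have "frac t = t"
        by (simp add: frac_eq)
      then show ?thesis
        using g t e' by simp
    next
      case 2
      then have "y = 0"
        using t e' assms by linarith
      moreover have "frac t = t + 1"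
        using 2 t e' \<open>y = 0\<close> by (subst frac_unique_iff) auto
      moreover have "1 / real a < x"
        using 2 elim assms by (simp add: t_def field_simps)
      ultimately show ?thesis
        using g t e' 2 by simp
    next
      case 3
      then have "y = 1"
        using t e' assms by linarith
      moreover have "frac t = t - 1"
        using 3 t e' \<open>y = 1\<close> by (subst frac_unique_iff) auto
      ultimately show ?thesis
        using g t e' 3 by simp
    qed
  qed
qed

section \<open>Shadowing the points of a word\<close>

text \<open>The factor 2 makes the balls of radius \<open>r\<close> about the points of
  \<open>S\<close> disjoint.\<close>

lemma finite_separated:
  fixes S :: "real set"
  assumes "finite S"
  obtains r where "0 < r" "\<And>x y. x \<in> S \<Longrightarrow> y \<in> S \<Longrightarrow> x \<noteq> y \<Longrightarrow> 2 * r \<le> \<bar>x - y\<bar>"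
proof -
  have "\<forall>\<^sub>F r in at_right (0::real). x \<noteq> y \<longrightarrow> 2 * r \<le> \<bar>x - y\<bar>" for x y :: real
  proof (cases "x = y")
    case False
    then show ?thesis
      unfolding eventually_at_right_field by (intro exI[of _ "\<bar>x - y\<bar> / 2"]) auto
  qed simp
  then have "\<forall>\<^sub>F r in at_right (0::real). \<forall>x\<in>S. \<forall>y\<in>S. x \<noteq> y \<longrightarrow> 2 * r \<le> \<bar>x - y\<bar>"
    using assms by (intro eventually_ball_finite ballI) auto
  moreover have "\<forall>\<^sub>F r in at_right (0::real). 0 < r"
    by (rule eventually_at_right_less)
  ultimately have "\<forall>\<^sub>F r in at_right (0::real). 0 < r \<and> (\<forall>x\<in>S. \<forall>y\<in>S. x \<noteq> y \<longrightarrow> 2 * r \<le> \<bar>x - y\<bar>)"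
    by eventually_elim auto
  then obtain r where "0 < r \<and> (\<forall>x\<in>S. \<forall>y\<in>S. x \<noteq> y \<longrightarrow> 2 * r \<le> \<bar>x - y\<bar>)"
    using eventually_happens' trivial_limit_at_right_real by blast
  then show thesis
    using that by auto
qed

text \<open>The potential \<open>v\<close> of the coboundary. Index 0 is left out so that
  \<open>v\<close> vanishes near \<open>p\<^sub>0\<close>; with disjoint balls, the convention
  \<open>V 0 = 0\<close> then makes \<open>V k\<close> the value near \<open>p\<^sub>k\<close> for
  every \<open>k\<close>.\<close>

definition step_fun :: "nat list \<Rightarrow> real \<Rightarrow> (nat \<Rightarrow> real) \<Rightarrow> real \<Rightarrow> real" where
  "step_fun as r V y = (\<Sum>k=1..length as. V k * indicator (ball (fcf_point as k) r) y)"

lemma step_fun_measurable [measurable]: "step_fun as r V \<in> borel_measurable borel"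
  unfolding step_fun_def[abs_def] by (intro borel_measurable_sum borel_measurable_times borel_measurable_indicator) auto

lemma step_fun_outside:
  assumes "\<And>k. 1 \<le> k \<Longrightarrow> k \<le> length as \<Longrightarrow> r \<le> \<bar>fcf_point as k - y\<bar>"
  shows "step_fun as r V y = 0"
proof -
  have "V k * indicator (ball (fcf_point as k) r) y = 0" if "k \<in> {1..length as}" for k
    using assms[of k] that by (simp add: dist_real_def)
  then show ?thesis
    unfolding step_fun_def by (intro sum.neutral) blast
qed

lemma step_fun_at:
  assumes "\<And>j. j \<le> length as \<Longrightarrow> j \<noteq> k \<Longrightarrow> 2 * r \<le> \<bar>fcf_point as j - fcf_point as k\<bar>"
    and "k \<le> length as" "V 0 = 0" "\<bar>y - fcf_point as k\<bar> < r"
  shows "step_fun as r V y = V k"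
proof -
  have "V j * indicator (ball (fcf_point as j) r) y = (if j = k then V k else 0)"
    if "j \<in> {1..length as}" for j
    using assms(1)[of j] assms(4) that by (auto simp: dist_real_def indicator_def)
  then have "step_fun as r V y = (\<Sum>j=1..length as. if j = k then V k else 0)"
    unfolding step_fun_def by (intro sum.cong) blast+
  also have "\<dots> = V k"
    using assms(2,3) by (cases "k = 0") auto
  finally show ?thesis .
qed

text \<open>
  The inequality \<open>V k \<le> v (G x)\<close> also covers the orbits that jump past a point of the cycle: these
  land near \<open>0\<close> or near \<open>1\<close> instead, where \<open>v\<close> is \<open>0\<close>. The last partial quotient may be \<open>1\<close>, and then
  \<open>1\<close> itself is the point \<open>p\<^sub>1\<close>.
\<close>

lemma fcf_shadowing:
  assumes as: "\<forall>a\<in>set as. 1 \<le> a"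
  obtains r r' where "0 < r" "0 < r'" "r' \<le> r"
    "\<And>j k. j \<le> length as \<Longrightarrow> k \<le> length as \<Longrightarrow> j \<noteq> k \<Longrightarrow> 2 * r \<le> \<bar>fcf_point as j - fcf_point as k\<bar>"
    "\<And>V k x. V 0 = 0 \<Longrightarrow> (\<And>k. k \<le> length as \<Longrightarrow> V k \<le> 0) \<Longrightarrow> k < length as \<Longrightarrow> x \<le> 1 \<Longrightarrow>
       \<bar>x - fcf_point as (Suc k)\<bar> < r' \<Longrightarrow> V k \<le> step_fun as r V (gauss_map x)"
proof -
  let ?p = "fcf_point as"
  let ?n = "length as"
  \<comment> \<open>The point 1 is included so that an orbit landing just below 1 stays at distance
    at least \<open>r\<close> from every \<open>p\<^sub>j\<close> other than 1.\<close>
  obtain r where r: "0 < r"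
    "\<And>x y. x \<in> insert 1 (?p ` {..?n}) \<Longrightarrow> y \<in> insert 1 (?p ` {..?n}) \<Longrightarrow> x \<noteq> y \<Longrightarrow> 2 * r \<le> \<bar>x - y\<bar>"
    using finite_separated[of "insert 1 (?p ` {..?n})"] by blast
  have sep: "2 * r \<le> \<bar>?p j - ?p k\<bar>" if "j \<le> ?n" "k \<le> ?n" "j \<noteq> k" for j k
    using r(2)[of "?p j" "?p k"] fcf_point_inj[OF as] that by (auto simp: inj_on_eq_iff)
  have sep1: "2 * r \<le> 1 - ?p j" if "j \<le> ?n" "?p j \<noteq> 1" for j
    using r(2)[of 1 "?p j"] fcf_point_bounds[OF as, of j] that by auto
  let ?P = "\<lambda>k x. \<bar>gauss_map x - ?p k\<bar> < r \<or> (?p k = 0 \<and> ?p (Suc k) < x \<and> 1 - r < gauss_map x \<and> gauss_map x \<le> 1) 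
    \<or> (?p k = 1 \<and> 0 \<le> gauss_map x \<and> gauss_map x < r)"
  have "\<forall>\<^sub>F d in at_right 0. \<forall>x. \<bar>x - ?p (Suc k)\<bar> < d \<longrightarrow> ?P k x" if "k < ?n" for k
  proof -
    have "\<forall>\<^sub>F x in nhds (?p (Suc k)). ?P k x"
      unfolding fcf_point_Suc[OF that]
      by (rule eventually_mono[OF gauss_map_near[of "as ! (?n - Suc k)" "?p k" r]])
         (use digit_ge_1[OF as that] fcf_point_bounds[OF as, of k] that r(1) in auto)
    then obtain d where "0 < d" "\<And>x. \<bar>x - ?p (Suc k)\<bar> < d \<Longrightarrow> ?P k x"
      unfolding eventually_nhds_metric dist_real_def by blast
    then show ?thesis
      unfolding eventually_at_right_field by (intro exI[of _ d]) auto
  qed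
  then have "\<forall>\<^sub>F d in at_right 0. \<forall>k\<in>{..<?n}. \<forall>x. \<bar>x - ?p (Suc k)\<bar> < d \<longrightarrow> ?P k x"
    by (intro eventually_ball_finite) auto
  moreover have "\<forall>\<^sub>F d in at_right 0. 0 < d \<and> d < r"
    using r(1) unfolding eventually_at_right_field by blast
  ultimately have "\<forall>\<^sub>F d in at_right 0. (0 < d \<and> d < r) \<and> (\<forall>k\<in>{..<?n}. \<forall>x. \<bar>x - ?p (Suc k)\<bar> < d \<longrightarrow> ?P k x)"
    by eventually_elim auto
  \<comment> \<open>One radius serves all steps from \<open>p\<^sub>k\<^sub>+\<^sub>1\<close> to
    \<open>p\<^sub>k\<close>, since there are finitely many.\<close>
  then obtain r' where r': "0 < r'" "r' < r" "\<And>k x. k < ?n \<Longrightarrow> \<bar>x - ?p (Suc k)\<bar> < r' \<Longrightarrow> ?P k x"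
    using eventually_happens'[OF trivial_limit_at_right_real] by blast
  have "V k \<le> step_fun as r V (gauss_map x)"
    if V: "V 0 = 0" "\<And>k. k \<le> ?n \<Longrightarrow> V k \<le> 0" and k: "k < ?n" and x: "x \<le> 1" "\<bar>x - ?p (Suc k)\<bar> < r'" for V k x
  proof -
    consider "\<bar>gauss_map x - ?p k\<bar> < r" 
      | "?p k = 0" "?p (Suc k) < x" "1 - r < gauss_map x" "gauss_map x \<le> 1" "r \<le> \<bar>gauss_map x - ?p k\<bar>"
      | "?p k = 1" "0 \<le> gauss_map x" "gauss_map x < r"
      using r'(3)[OF k x(2)] by linarith
    then show ?thesis
    proof cases
      case 1
      then show ?thesis
        using step_fun_at[of as k r V "gauss_map x"] sep k V by simp
    next
      case 2
      then have "k = 0"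
        using fcf_point_pos[OF as, of k] k by fastforce
      \<comment> \<open>Jumping past 0 to land near 1 takes place only to the right of
        \<open>p\<^sub>1\<close>. If \<open>p\<^sub>1\<close> were 1, such an \<open>x\<close> would
        lie outside the unit interval. Hence no point of the word is 1, and \<open>v\<close> is 0
        where the orbit lands.\<close>
      then have "?p 1 \<noteq> 1"
        using 2 x(1) by auto
      have "r \<le> \<bar>?p j - gauss_map x\<bar>" if "1 \<le> j" "j \<le> ?n" for j
        using sep1[of j] fcf_point_eq_1[OF as, of j] 2 that \<open>?p 1 \<noteq> 1\<close> r(1) by fastforce
      then have "step_fun as r V (gauss_map x) = 0"
        by (intro step_fun_outside)
      then show ?thesis
        using V(2)[of k] k by simp
    next
      case 3
      have "step_fun as r V (gauss_map x) = V 0"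
        by (rule step_fun_at) (use sep[of _ 0] V 3 in auto)
      then show ?thesis
        using V k by simp
    qed
  qed
  then show thesis
    using that[OF r(1) r'(1)] r'(2) sep by auto
qed

section \<open>Powers of distances and continuity of Hoelder functions\<close>

text \<open>After division by \<open>a + b\<close> both summands lie in [0,1], where a number is at
  most its power with exponent \<alpha> \<le> 1.\<close>

lemma powr_add_le:
  fixes a b \<alpha> :: real
  assumes "0 \<le> a" "0 \<le> b" "0 < \<alpha>" "\<alpha> \<le> 1"
  shows "(a + b) powr \<alpha> \<le> a powr \<alpha> + b powr \<alpha>"
proof (cases "a + b = 0")
  case False
  then have pos: "0 < a + b"
    using assms by linarith
  have part: "x / (a + b) * (a + b) powr \<alpha> \<le> x powr \<alpha>" if "0 \<le> x" "x \<le> a + b" for x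
  proof -
    have "x / (a + b) = (x / (a + b)) powr 1"
      using that pos by simp
    also have "\<dots> \<le> (x / (a + b)) powr \<alpha>"
      using that pos assms by (intro powr_mono') auto
    finally show ?thesis
      using that pos by (simp add: powr_divide pos_divide_le_eq pos_le_divide_eq)
  qed
  have "(a + b) powr \<alpha> = a / (a + b) * (a + b) powr \<alpha> + b / (a + b) * (a + b) powr \<alpha>"
    using pos by (simp flip: distrib_right add_divide_distrib)
  then show ?thesis
    using part[of a] part[of b] assms by linarith
qed (use assms in auto)

text \<open>The power of the distance is again a metric; therefore a multiple \<open>K\<close> of
  the power of the distance to a fixed point satisfies the Hoelder estimate with constant
  \<open>K\<close>.\<close>

lemma abs_diff_powr_triangle:
  fixes x y z \<alpha> :: real
  assumes "0 < \<alpha>" "\<alpha> \<le> 1"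
  shows "\<bar>x - z\<bar> powr \<alpha> \<le> \<bar>x - y\<bar> powr \<alpha> + \<bar>y - z\<bar> powr \<alpha>"
proof -
  have "\<bar>x - z\<bar> powr \<alpha> \<le> (\<bar>x - y\<bar> + \<bar>y - z\<bar>) powr \<alpha>"
    using assms by (intro powr_mono2) auto
  also have "\<dots> \<le> \<bar>x - y\<bar> powr \<alpha> + \<bar>y - z\<bar> powr \<alpha>"
    using assms by (intro powr_add_le) auto
  finally show ?thesis .
qed

lemma holder_estimate_continuous:
  fixes f :: "real \<Rightarrow> real"
  assumes "0 < \<alpha>" "\<And>x y. x \<in> S \<Longrightarrow> y \<in> S \<Longrightarrow> \<bar>f x - f y\<bar> \<le> C * \<bar>x - y\<bar> powr \<alpha>"
  shows "continuous_on S f"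
  unfolding continuous_on_def
proof
  fix x assume x: "x \<in> S"
  have "((\<lambda>y. C * \<bar>y - x\<bar> powr \<alpha>) \<longlongrightarrow> C * 0) (at x within S)"
  proof (rule tendsto_mult[OF tendsto_const])
    have "((\<lambda>y. \<bar>y - x\<bar>) \<longlongrightarrow> 0) (at x within S)"
      by (rule tendsto_eq_intros refl | simp)+
    then show "((\<lambda>y. \<bar>y - x\<bar> powr \<alpha>) \<longlongrightarrow> 0) (at x within S)"
      using assms(1) by (intro tendsto_zero_powrI[OF _ tendsto_const]) auto
  qed
  then have "((\<lambda>y. C * \<bar>y - x\<bar> powr \<alpha>) \<longlongrightarrow> 0) (at x within S)"
    by simp
  then have "((\<lambda>y. f y - f x) \<longlongrightarrow> 0) (at x within S)"
  proof (rule Lim_null_comparison[rotated])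
    show "\<forall>\<^sub>F y in at x within S. norm (f y - f x) \<le> C * \<bar>y - x\<bar> powr \<alpha>"
      using assms(2) x unfolding eventually_at_filter by auto
  qed
  then show "(f \<longlongrightarrow> f x) (at x within S)"
    by (rule LIM_zero_cancel)
qed

lemma holder_space_continuous:
  assumes "f \<in> holder_space \<alpha>" "0 < \<alpha>"
  shows "continuous_on {0..1} f"
proof -
  obtain C where "\<And>x y. x \<in> {0..1} \<Longrightarrow> y \<in> {0..1} \<Longrightarrow> \<bar>f x - f y\<bar> \<le> C * \<bar>x - y\<bar> powr \<alpha>"
    using assms(1) unfolding holder_space_def by blast
  then show ?thesis
    by (rule holder_estimate_continuous[OF assms(2)])
qed

section \<open>Integrals against probability measures on the unit interval\<close>

lemma prob_unit_borelD:
  assumes "\<nu> \<in> space (prob_algebra unit_borel)"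
  shows "prob_space \<nu>" "sets \<nu> = sets unit_borel" "space \<nu> = {0..1}"
proof -
  show p: "prob_space \<nu>" "sets \<nu> = sets unit_borel"
    using assms by (auto simp: space_prob_algebra)
  show "space \<nu> = {0..1}"
    using sets_eq_imp_space_eq[OF p(2)] by (simp add: space_restrict_space)
qed

lemma integrable_unit_borel:
  fixes f :: "real \<Rightarrow> real"
  assumes "\<nu> \<in> space (prob_algebra unit_borel)" "f \<in> borel_measurable unit_borel"
    and "\<And>x. x \<in> {0..1} \<Longrightarrow> \<bar>f x\<bar> \<le> B"
  shows "integrable \<nu> f"
proof -
  interpret prob_space \<nu>
    using prob_unit_borelD[OF assms(1)] by simp
  have "f \<in> borel_measurable \<nu>"
    using assms(2) measurable_cong_sets[OF prob_unit_borelD(2)[OF assms(1)] refl] by blast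
  then show ?thesis
    using assms(3) prob_unit_borelD(3)[OF assms(1)] by (intro integrable_const_bound[of _ B]) auto
qed

lemma continuous_on_unit_bounded:
  fixes f :: "real \<Rightarrow> real"
  assumes "continuous_on {0..1} f"
  shows "\<exists>B. \<forall>x\<in>{0..1}. \<bar>f x\<bar> \<le> B"
proof -
  have "bounded (f ` {0..1})"
    using assms by (intro compact_imp_bounded compact_continuous_image) auto
  then show ?thesis
    by (auto simp: bounded_iff)
qed

lemma integrable_unit_continuous:
  fixes f :: "real \<Rightarrow> real"
  assumes "\<nu> \<in> space (prob_algebra unit_borel)" "continuous_on {0..1} f"
  shows "integrable \<nu> f"
proof -
  obtain B where "\<And>x. x \<in> {0..1} \<Longrightarrow> \<bar>f x\<bar> \<le> B"
    using continuous_on_unit_bounded[OF assms(2)] by blast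
  then show ?thesis
    using assms by (intro integrable_unit_borel[of _ _ B] borel_measurable_continuous_on_restrict)
qed

lemma integral_unit_cong:
  assumes "\<nu> \<in> space (prob_algebra unit_borel)" "\<And>x. x \<in> {0..1} \<Longrightarrow> f x = g x"
  shows "integral\<^sup>L \<nu> f = integral\<^sup>L \<nu> g"
  using assms prob_unit_borelD(3)[OF assms(1)] by (intro Bochner_Integration.integral_cong) auto

lemma invariant_measuresD:
  assumes "\<nu> \<in> invariant_measures"
  shows "\<nu> \<in> space (prob_algebra unit_borel)" "distr \<nu> unit_borel gauss_map = \<nu>"
  using assms by (auto simp: invariant_measures_def)

lemma limit_measures_prob:
  assumes "\<nu> \<in> limit_measures"
  shows "\<nu> \<in> space (prob_algebra unit_borel)"
  using assms closure_of_subset_topspace[of weak_star_topology] 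
  unfolding limit_measures_def topspace_weak_star by blast

text \<open>Otherwise the measures whose integral of \<open>f\<close> exceeds the supremum would
  form a weak* neighbourhood of \<open>\<nu>\<close> without invariant measures.\<close>

lemma integral_le_max_integral:
  assumes "\<nu> \<in> limit_measures" "continuous_on {0..1} f"
  shows "integral\<^sup>L \<nu> f \<le> max_integral f"
proof -
  obtain B where B: "\<And>x. x \<in> {0..1} \<Longrightarrow> \<bar>f x\<bar> \<le> B"
    using continuous_on_unit_bounded[OF assms(2)] by blast
  have le: "integral\<^sup>L \<mu> f \<le> B" if "\<mu> \<in> invariant_measures" for \<mu>
  proof -
    note \<mu> = invariant_measuresD(1)[OF that]
    interpret prob_space \<mu>
      using prob_unit_borelD[OF \<mu>] by simp
    show ?thesis
      using abs_le_D1[OF B] prob_unit_borelD(3)[OF \<mu>]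
      by (intro integral_le_const integrable_unit_continuous[OF \<mu> assms(2)] AE_I2) simp
  qed
  show ?thesis
  proof (rule ccontr)
    assume less: "\<not> ?thesis"
    let ?T = "{\<mu> \<in> space (prob_algebra unit_borel). integral\<^sup>L \<mu> f \<in> {max_integral f<..}}"
    have "openin weak_star_topology ?T"
      unfolding weak_star_topology_def openin_topology_generated_by_iff
      using assms(2)
      by (intro generate_topology_on.Basis CollectI exI[of _ f] exI[of _ "{max_integral f<..}"]) simp
    moreover have "\<nu> \<in> ?T"
      using less limit_measures_prob[OF assms(1)] by simp
    moreover have "\<nu> \<in> weak_star_topology closure_of invariant_measures"
      using assms(1) unfolding limit_measures_def .
    ultimately have "\<exists>\<mu>. \<mu> \<in> invariant_measures \<and> \<mu> \<in> ?T"
      by (intro mp[OF spec[OF conjunct2[OF in_closure_of[THEN iffD1]], of _ _ _ ?T]] conjI)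
    then obtain \<mu> where \<mu>: "\<mu> \<in> invariant_measures" "max_integral f < integral\<^sup>L \<mu> f"
      by auto
    \<comment> \<open>The supremum is taken in the reals, so it is known to be an upper bound only
      once the integrals are bounded.\<close>
    have "bdd_above ((\<lambda>\<nu>. integral\<^sup>L \<nu> f) ` invariant_measures)"
      using le by (rule bdd_aboveI2)
    with \<mu>(1) have "integral\<^sup>L \<mu> f \<le> max_integral f"
      unfolding max_integral_def by (rule cSUP_upper)
    then show False
      using \<mu>(2) by simp
  qed
qed

text \<open>Comparison with invariant measures bounds the supremum, which is over a nonempty set
  because of the Dirac measure at 0; the reverse inequality holds for every limit measure.\<close>

lemma limit_maximizingI:
  assumes "\<mu> \<in> limit_measures" "continuous_on {0..1} f"
    and "\<And>\<nu>. \<nu> \<in> invariant_measures \<Longrightarrow> integral\<^sup>L \<nu> f \<le> integral\<^sup>L \<mu> f"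
  shows "limit_maximizing f \<mu>"
proof -
  have "max_integral f \<le> integral\<^sup>L \<mu> f"
    unfolding max_integral_def using return_0_invariant assms(3) by (intro cSUP_least) blast+
  then show ?thesis
    using integral_le_max_integral[OF assms(1,2)] assms(1) by (simp add: limit_maximizing_def)
qed

section \<open>Finite-continued-fraction measures\<close>

lemma fcf_point_in_unit:
  assumes "\<forall>a\<in>set as. 1 \<le> a"
  shows "fcf_point as k \<in> {0..1}"
proof (cases "k \<le> length as")
  case True
  then show ?thesis
    using fcf_point_bounds[OF assms] by simp
next
  case False
  \<comment> \<open>Subtraction on the naturals truncates, so beyond the length nothing is dropped.
    Having all \<open>k\<close> makes \<open>fcf_point as\<close> a map from all naturals into
    [0,1], as the image measure below requires.\<close>
  then have "fcf_point as k = fcf_point as (length as)"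
    by (simp add: fcf_point_def)
  then show ?thesis
    using fcf_point_bounds[OF assms, of "length as"] by simp
qed

text \<open>As the image of the uniform distribution on the indices, the measure integrates
  functions by finite averages.\<close>

lemma fcf_measure_eq_distr:
  assumes "\<forall>a\<in>set as. 1 \<le> a"
  shows "fcf_measure as = distr (pmf_of_set {..length as}) unit_borel (fcf_point as)"
proof (rule measure_eqI)
  fix A assume "A \<in> sets (fcf_measure as)"
  then have A: "A \<in> sets unit_borel"
    by (simp add: sets_fcf_measure)
  have meas: "fcf_point as \<in> measurable (pmf_of_set {..length as}) unit_borel"
    using fcf_point_in_unit[OF assms] by (simp add: space_restrict_space)
  have "emeasure (distr (pmf_of_set {..length as}) unit_borel (fcf_point as)) A =
      (\<integral>\<^sup>+ x. indicator A x \<partial>distr (pmf_of_set {..length as}) unit_borel (fcf_point as))"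
    using A by (intro nn_integral_indicator[symmetric]) simp
  also have "\<dots> = (\<integral>\<^sup>+ k. indicator A (fcf_point as k) \<partial>pmf_of_set {..length as})"
    using A by (intro nn_integral_distr[OF meas]) simp
  also have "\<dots> = emeasure (fcf_measure as) A"
    by (subst nn_integral_pmf_of_set) (simp_all add: emeasure_fcf_measure[OF A])
  finally show "emeasure (fcf_measure as) A = emeasure (distr (pmf_of_set {..length as}) unit_borel (fcf_point as)) A"
    by simp
qed (simp add: sets_fcf_measure)

lemma integral_fcf_measure:
  fixes f :: "real \<Rightarrow> real"
  assumes "\<forall>a\<in>set as. 1 \<le> a" "continuous_on {0..1} f"
  shows "integral\<^sup>L (fcf_measure as) f = (\<Sum>k\<le>length as. f (fcf_point as k)) / (real (length as) + 1)"
proof -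
  have "integral\<^sup>L (fcf_measure as) f = (\<integral>k. f (fcf_point as k) \<partial>pmf_of_set {..length as})"
    unfolding fcf_measure_eq_distr[OF assms(1)] using fcf_point_in_unit[OF assms(1)]
    by (intro integral_distr borel_measurable_continuous_on_restrict assms(2)) (simp add: space_restrict_space)
  then show ?thesis
    by (simp add: integral_pmf_of_set add.commute)
qed

lemma fcf_measure_Nil: "fcf_measure [] = return unit_borel 0"
  by (rule measure_eqI) (auto simp: sets_fcf_measure emeasure_fcf_measure divide_ennreal_def)

lemma finitely_supported_fcf_measure:
  assumes "\<forall>a\<in>set as. 1 \<le> a"
  shows "finitely_supported (fcf_measure as)"
  unfolding finitely_supported_def
proof (intro exI conjI)
  let ?F = "fcf_point as ` {..length as}"
  show "?F \<subseteq> {0..1}"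
    using fcf_point_in_unit[OF assms] by blast
  have "{0..1} - ?F \<in> sets borel"
    by (intro sets.Diff borel_closed[OF finite_imp_closed] borel_closed[OF closed_atLeastAtMost]) auto
  then have "{0..1} - ?F \<in> sets unit_borel"
    by (simp add: sets_restrict_space_iff)
  then show "emeasure (fcf_measure as) ({0..1} - ?F) = 0"
    by (simp add: emeasure_fcf_measure)
qed simp

section \<open>Coboundaries and robust minimality of FCF measures\<close>

lemma step_fun_bounds:
  assumes V: "V 0 = 0" "\<And>k. k \<le> length as \<Longrightarrow> V k \<le> 0" "\<And>k. k \<le> length as \<Longrightarrow> L \<le> V k"
    and sep: "\<And>j k. j \<le> length as \<Longrightarrow> k \<le> length as \<Longrightarrow> j \<noteq> k \<Longrightarrow>
      2 * r \<le> \<bar>fcf_point as j - fcf_point as k\<bar>"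
  shows "L \<le> step_fun as r V y" "step_fun as r V y \<le> 0"
proof -
  have "L \<le> step_fun as r V y \<and> step_fun as r V y \<le> 0"
  proof (cases "\<exists>k\<le>length as. \<bar>y - fcf_point as k\<bar> < r")
    case True
    then obtain k where k: "k \<le> length as" "\<bar>y - fcf_point as k\<bar> < r"
      by blast
    have "step_fun as r V y = V k"
      by (rule step_fun_at) (use sep k V(1) in auto)
    then show ?thesis
      using V k by simp
  next
    case False
    then have "step_fun as r V y = 0"
      by (intro step_fun_outside) (auto simp: abs_minus_commute not_less)
    then show ?thesis
      using V(1) V(3)[of 0] by simp
  qed
  then show "L \<le> step_fun as r V y" "step_fun as r V y \<le> 0"
    by auto
qed

text \<open>By invariance \<open>v\<close> and its composition with \<open>gauss_map\<close> have
  the same integral. Bounded Borel functions are allowed because the step function is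
  discontinuous.\<close>

lemma integral_coboundary:
  fixes v :: "real \<Rightarrow> real"
  assumes "\<nu> \<in> invariant_measures" "v \<in> borel_measurable borel" "\<And>x. \<bar>v x\<bar> \<le> B"
  shows "integrable \<nu> (\<lambda>x. v x - v (gauss_map x))" "(\<integral>x. v x - v (gauss_map x) \<partial>\<nu>) = 0"
proof -
  note \<nu> = invariant_measuresD[OF assms(1)]
  have v: "v \<in> borel_measurable unit_borel"
    using assms(2) by (rule measurable_restrict_space1)
  have vG: "(\<lambda>x. v (gauss_map x)) \<in> borel_measurable unit_borel"
    by (rule measurable_compose[OF gauss_map_measurable v])
  have int: "integrable \<nu> v" "integrable \<nu> (\<lambda>x. v (gauss_map x))"
    using assms(3) by (auto intro!: integrable_unit_borel[OF \<nu>(1), of _ B] v vG)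
  show "integrable \<nu> (\<lambda>x. v x - v (gauss_map x))"
    using int by simp
  have "gauss_map \<in> measurable \<nu> unit_borel"
    using gauss_map_measurable measurable_cong_sets[OF prob_unit_borelD(2)[OF \<nu>(1)] refl] by blast
  from integral_distr[OF this v] have "(\<integral>x. v (gauss_map x) \<partial>\<nu>) = integral\<^sup>L \<nu> v"
    using \<nu>(2) by simp
  then show "(\<integral>x. v x - v (gauss_map x) \<partial>\<nu>) = 0"
    using int by simp
qed

text \<open>With \<open>qb\<close> the average of the numbers
  \<open>q k = c k + h (p\<^sub>k)\<close>, the function \<open>g + h\<close> dominates
  \<open>qb\<close> plus a coboundary. So every invariant measure gives it at least
  \<open>qb\<close>, and the FCF measure gives it at most \<open>qb\<close>. Only \<open>qb\<close>
  and \<open>v\<close> are adapted to \<open>h\<close>; \<open>g\<close> and \<delta> are fixed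
  beforehand.\<close>

lemma fcf_robust_minimum:
  assumes as: "\<forall>a\<in>set as. 1 \<le> a" and \<alpha>: "0 < \<alpha>" "\<alpha> \<le> 1"
  obtains g \<delta> where "g \<in> holder_space \<alpha>" "0 < \<delta>"
    "\<And>h \<nu>. \<nu> \<in> invariant_measures \<Longrightarrow> (\<And>x. x \<in> {0..1} \<Longrightarrow> \<bar>h x\<bar> \<le> \<delta>) \<Longrightarrow>
      (\<And>x y. x \<in> {0..1} \<Longrightarrow> y \<in> {0..1} \<Longrightarrow> \<bar>h x - h y\<bar> \<le> \<delta> * \<bar>x - y\<bar> powr \<alpha>) \<Longrightarrow>
      (\<integral>x. g x + h x \<partial>fcf_measure as) \<le> (\<integral>x. g x + h x \<partial>\<nu>)"
proof -
  let ?p = "fcf_point as"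
  let ?n = "length as"
  obtain r r' where r: "0 < r" "0 < r'" "r' \<le> r"
    and sep: "\<And>j k. j \<le> ?n \<Longrightarrow> k \<le> ?n \<Longrightarrow> j \<noteq> k \<Longrightarrow> 2 * r \<le> \<bar>?p j - ?p k\<bar>"
    and shadow: "\<And>V k x. V 0 = 0 \<Longrightarrow> (\<And>k. k \<le> ?n \<Longrightarrow> V k \<le> 0) \<Longrightarrow> k < ?n \<Longrightarrow> x \<le> 1 \<Longrightarrow>
       \<bar>x - ?p (Suc k)\<bar> < r' \<Longrightarrow> V k \<le> step_fun as r V (gauss_map x)"
    using fcf_shadowing[OF as] by blast
  define N where "N = real ?n + 1"
  \<comment> \<open>With \<open>N * \<delta> = 1 / 2\<close> the \<open>q k\<close> sum to at least
    \<open>1 - N * \<delta> = 1 / 2\<close>, so their average \<open>qb\<close> is at least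
    \<delta>, and hence at least every \<open>q k\<close> with \<open>1 \<le> k\<close>.\<close>
  define \<delta> where "\<delta> = 1 / (2 * N)"
  \<comment> \<open>The first summand makes the cones of \<open>G\<close> rise by 2 at distance
    \<open>r'\<close>; the extra 1 absorbs the Hoelder constant \<delta> of
    \<open>h\<close>.\<close>
  define K where "K = 2 / r' powr \<alpha> + 1"
  define c where "c k = (if k = 0 then 1 else 0 :: real)" for k :: nat
  \<comment> \<open>The lower envelope of cones with vertices at height \<open>c k\<close> over
    \<open>p\<^sub>k\<close>. Every cone has Hoelder constant \<open>K\<close>, hence so has their
    minimum; the height 1 over \<open>p\<^sub>0\<close> is the price of a visit to 0.\<close>
  define G where "G x = Min ((\<lambda>k. c k + K * \<bar>x - ?p k\<bar> powr \<alpha>) ` {..?n})" for x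
  define g where "g = restrict G {0..1}"
  have N: "1 \<le> N"
    by (simp add: N_def)
  have \<delta>: "0 < \<delta>" "\<delta> \<le> 1 / 2" "N * \<delta> = 1 / 2"
    using N by (auto simp: \<delta>_def field_simps)
  have K: "0 \<le> K" "1 \<le> K" "2 \<le> (K - \<delta>) * r' powr \<alpha>"
  proof -
    have "2 = (K - 1) * r' powr \<alpha>"
      using r by (simp add: K_def)
    also have "\<dots> \<le> (K - \<delta>) * r' powr \<alpha>"
      using \<delta> by (intro mult_right_mono) auto
    finally show "2 \<le> (K - \<delta>) * r' powr \<alpha>" .
  qed (simp_all add: K_def)
  have G_le: "G x \<le> c k + K * \<bar>x - ?p k\<bar> powr \<alpha>" if "k \<le> ?n" for x k
    unfolding G_def using that by (intro Min_le) auto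
  have G_ex: "\<exists>k\<le>?n. G x = c k + K * \<bar>x - ?p k\<bar> powr \<alpha>" for x
  proof -
    have "G x \<in> (\<lambda>k. c k + K * \<bar>x - ?p k\<bar> powr \<alpha>) ` {..?n}"
      unfolding G_def by (intro Min_in) auto
    then show ?thesis
      by auto
  qed
  have G1: "G x - G y \<le> K * \<bar>x - y\<bar> powr \<alpha>" for x y
  proof -
    obtain k where k: "k \<le> ?n" "G y = c k + K * \<bar>y - ?p k\<bar> powr \<alpha>"
      using G_ex by blast
    have "K * \<bar>x - ?p k\<bar> powr \<alpha> \<le> K * (\<bar>x - y\<bar> powr \<alpha> + \<bar>y - ?p k\<bar> powr \<alpha>)"
      using K(1) \<alpha> by (intro mult_left_mono abs_diff_powr_triangle)
    then show ?thesis
      using G_le[OF k(1), of x] k(2) by (simp add: distrib_left)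
  qed
  have G_holder: "\<bar>G x - G y\<bar> \<le> K * \<bar>x - y\<bar> powr \<alpha>" for x y
    using G1[of x y] G1[of y x] by (simp add: abs_minus_commute abs_le_iff)
  have g: "g \<in> holder_space \<alpha>"
    using G_holder by (auto simp: g_def holder_space_def)
  have "(\<integral>x. g x + h x \<partial>fcf_measure as) \<le> (\<integral>x. g x + h x \<partial>\<nu>)"
    if \<nu>: "\<nu> \<in> invariant_measures" and h: "\<And>x. x \<in> {0..1} \<Longrightarrow> \<bar>h x\<bar> \<le> \<delta>"
      "\<And>x y. x \<in> {0..1} \<Longrightarrow> y \<in> {0..1} \<Longrightarrow> \<bar>h x - h y\<bar> \<le> \<delta> * \<bar>x - y\<bar> powr \<alpha>" for h \<nu>
  proof -
    note p01 = fcf_point_in_unit[OF as]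
    define q where "q k = c k + h (?p k)" for k
    define qb where "qb = (\<Sum>k\<le>?n. q k) / N"
    \<comment> \<open>Chosen so that \<open>q k - qb = V k - V (k - 1)\<close> for \<open>1 \<le> k\<close>, while \<open>V n = qb - q 0\<close> bounds \<open>V\<close> below.\<close>
    define V where "V k = (\<Sum>i=1..k. q i - qb)" for k
    define v where "v = step_fun as r V"
    have q: "q 0 \<le> 1 + \<delta>" "1 - \<delta> \<le> q 0" "\<And>k. - \<delta> \<le> q k" "\<And>k. 1 \<le> k \<Longrightarrow> q k \<le> \<delta>"
    proof -
      have "h (?p k) \<le> \<delta>" "- \<delta> \<le> h (?p k)" for k
        using h(1)[OF p01[of k]] by (simp_all add: abs_le_iff)
      note hk = this
      have "h (?p k) \<le> q k" for k
        by (simp add: q_def c_def)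
      then show "- \<delta> \<le> q k" for k
        using hk(2)[of k] by (rule order_trans[rotated])
      show "q 0 \<le> 1 + \<delta>" "1 - \<delta> \<le> q 0"
        using hk[of 0] by (auto simp: q_def c_def)
      show "1 \<le> k \<Longrightarrow> q k \<le> \<delta>" for k
        using hk(1)[of k] by (simp add: q_def c_def)
    qed
    have split: "(\<Sum>k\<le>?n. f k) = f 0 + (\<Sum>k=1..?n. f k)" for f :: "nat \<Rightarrow> real"
      using sum.atLeast_Suc_atMost[of 0 ?n f] by (simp add: atMost_atLeast0)
    have "(\<Sum>k=1..?n. - \<delta>) \<le> (\<Sum>k=1..?n. q k)"
      using q by (intro sum_mono) auto
    then have "1 / 2 \<le> (\<Sum>k\<le>?n. q k)"
      using q(2) \<delta>(3) unfolding split N_def by (simp add: algebra_simps)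
    then have qb: "\<delta> \<le> qb"
      unfolding qb_def using N \<delta>(3) by (simp add: pos_le_divide_eq mult.commute)
    have q_le: "q k \<le> qb" if "1 \<le> k" for k
      using q(4)[OF that] qb by linarith
    have V0: "V 0 = 0"
      by (simp add: V_def)
    have V_Suc: "V (Suc k) = V k + (q (Suc k) - qb)" for k
      by (simp add: V_def)
    have V_le: "V k \<le> 0" for k
      unfolding V_def using q_le by (intro sum_nonpos) auto
    have V_n: "V ?n = qb - q 0"
    proof -
      have "(\<Sum>k\<le>?n. q k) = N * qb"
        using N by (simp add: qb_def)
      then show ?thesis
        unfolding split V_def N_def by (simp add: sum_subtractf algebra_simps)
    qed
    have V_ge: "qb - q 0 \<le> V k" if "k \<le> ?n" for k
    proof -
      \<comment> \<open>The increments \<open>q i - qb\<close> of \<open>V\<close> are nonpositive,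
        so its least value is the last one.\<close>
      have "(\<Sum>i=1..k. qb - q i) \<le> (\<Sum>i=1..?n. qb - q i)"
        using that q_le by (intro sum_mono2) auto
      then have "V ?n \<le> V k"
        by (simp add: V_def sum_subtractf)
      then show ?thesis
        using V_n by simp
    qed
    have v: "qb - q 0 \<le> v y" "v y \<le> 0" for y
      unfolding v_def using step_fun_bounds[of V as "qb - q 0" r y] V0 V_le V_ge sep by auto
    have main: "qb + (v x - v (gauss_map x)) \<le> g x + h x" if x: "x \<in> {0..1}" for x
    proof -
      \<comment> \<open>The cone that attains the minimum at \<open>x\<close>. Replacing
        \<open>h x\<close> by its value at the vertex costs \<delta> of the factor
        \<open>K\<close>.\<close>
      obtain k where k: "k \<le> ?n" "G x = c k + K * \<bar>x - ?p k\<bar> powr \<alpha>"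
        using G_ex by blast
      have "h (?p k) - h x \<le> \<delta> * \<bar>x - ?p k\<bar> powr \<alpha>"
        using h(2)[OF x p01[of k]] by (simp add: abs_le_iff)
      then have ge: "q k + (K - \<delta>) * \<bar>x - ?p k\<bar> powr \<alpha> \<le> g x + h x"
        using k x by (simp add: g_def q_def algebra_simps)
      show ?thesis
      proof (cases "\<bar>x - ?p k\<bar> < r'")
        case True
        have "0 \<le> (K - \<delta>) * \<bar>x - ?p k\<bar> powr \<alpha>"
          using K \<delta> by (intro mult_nonneg_nonneg) auto
        then have ge': "q k \<le> g x + h x"
          using ge by simp
        have vx: "v x = V k"
          unfolding v_def by (rule step_fun_at) (use sep k V0 True r in auto)
        show ?thesis
        proof (cases k)
          \<comment> \<open>Near 0 the image under \<open>gauss_map\<close> may be anywhere, so the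
            global lower bound of \<open>v\<close> is applied:
            \<open>qb - v (gauss_map x) \<le> q 0\<close>.\<close>
          case 0
          then show ?thesis
            using ge' vx V0 v(1)[of "gauss_map x"] by simp
        next
          case (Suc j)
          \<comment> \<open>Along the word, \<open>V k - V j = q k - qb\<close> turns the bound from
            shadowing into \<open>qb + v x - v (gauss_map x) \<le> q k\<close>.\<close>
          have "V j \<le> v (gauss_map x)"
            unfolding v_def by (rule shadow) (use Suc k True x V0 V_le in auto)
          then show ?thesis
            using ge' vx V_Suc[of j] Suc by simp
        qed
      next
        case False
        have "r' powr \<alpha> \<le> \<bar>x - ?p k\<bar> powr \<alpha>"
          using False r \<alpha> by (intro powr_mono2) auto
        then have "(K - \<delta>) * r' powr \<alpha> \<le> (K - \<delta>) * \<bar>x - ?p k\<bar> powr \<alpha>"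
          using K \<delta> by (intro mult_left_mono) auto
        \<comment> \<open>Away from the vertex the crude bounds on \<open>v\<close> suffice: the
          left side is at most \<open>q 0 \<le> 1 + \<delta>\<close>, the right side at least
          \<open>2 - \<delta>\<close>, and \<delta> is at most 1/2.\<close>
        then have "q k + 2 \<le> g x + h x"
          using ge K(3) by linarith
        then show ?thesis
          using v(1)[of "gauss_map x"] v(2)[of x] q(1) q(3)[of k] \<delta>(2) by linarith
      qed
    qed
    have cont: "continuous_on {0..1} (\<lambda>x. g x + h x)"
      using holder_space_continuous[OF g \<alpha>(1)] holder_estimate_continuous[OF \<alpha>(1), of "{0..1}" h \<delta>] h(2)
      by (intro continuous_on_add) auto
    note \<nu>' = invariant_measuresD(1)[OF \<nu>]
    interpret prob_space \<nu>
      using prob_unit_borelD[OF \<nu>'] by simp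
    have "v \<in> borel_measurable borel"
      unfolding v_def by measurable
    moreover have "\<bar>v x\<bar> \<le> \<bar>qb - q 0\<bar>" for x
      using v[of x] by linarith
    ultimately have cob: "integrable \<nu> (\<lambda>x. v x - v (gauss_map x))" "(\<integral>x. v x - v (gauss_map x) \<partial>\<nu>) = 0"
      using integral_coboundary[OF \<nu>] by blast+
    have "qb = (\<integral>x. qb + (v x - v (gauss_map x)) \<partial>\<nu>)"
      using cob by (subst Bochner_Integration.integral_add) (simp_all add: prob_space)
    also have "\<dots> \<le> (\<integral>x. g x + h x \<partial>\<nu>)"
      using main cob(1) prob_unit_borelD(3)[OF \<nu>']
      by (intro integral_mono integrable_unit_continuous[OF \<nu>' cont] Bochner_Integration.integrable_add) auto
    finally have "qb \<le> (\<integral>x. g x + h x \<partial>\<nu>)" .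
    \<comment> \<open>\<open>p\<^sub>k\<close> is the vertex of its own cone, where \<open>G\<close>
      is at most \<open>c k\<close>.\<close>
    moreover have "g (?p k) + h (?p k) \<le> q k" if "k \<le> ?n" for k
      using G_le[OF that, of "?p k"] p01[of k] \<alpha> by (simp add: g_def q_def)
    then have "(\<integral>x. g x + h x \<partial>fcf_measure as) \<le> qb"
      unfolding integral_fcf_measure[OF as cont] qb_def N_def
      by (intro divide_right_mono sum_mono) auto
    ultimately show ?thesis
      by linarith
  qed
  then show thesis
    using that[OF g \<delta>(1)] by blast
qed

section \<open>Estimates in the Hoelder norm\<close>

text \<open>One constant for both bounds, and positive, so that a perturbation size can be divided
  by it.\<close>

lemma holder_space_estimates:
  assumes "f \<in> holder_space \<alpha>" "0 < \<alpha>"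
  obtains D where "0 < D" "\<And>x. x \<in> {0..1} \<Longrightarrow> \<bar>f x\<bar> \<le> D"
    "\<And>x y. x \<in> {0..1} \<Longrightarrow> y \<in> {0..1} \<Longrightarrow> \<bar>f x - f y\<bar> \<le> D * \<bar>x - y\<bar> powr \<alpha>"
proof -
  obtain C where C: "\<And>x y. x \<in> {0..1} \<Longrightarrow> y \<in> {0..1} \<Longrightarrow> \<bar>f x - f y\<bar> \<le> C * \<bar>x - y\<bar> powr \<alpha>"
    using assms(1) unfolding holder_space_def by blast
  obtain B where B: "\<And>x. x \<in> {0..1} \<Longrightarrow> \<bar>f x\<bar> \<le> B"
    using continuous_on_unit_bounded[OF holder_space_continuous[OF assms]] by blast
  define D where "D = max 1 (max B C)"
  have "\<bar>f x - f y\<bar> \<le> D * \<bar>x - y\<bar> powr \<alpha>" if "x \<in> {0..1}" "y \<in> {0..1}" for x y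
    using C[OF that] by (rule order_trans) (auto intro!: mult_right_mono simp: D_def)
  moreover have "\<bar>f x\<bar> \<le> D" if "x \<in> {0..1}" for x
    using B[OF that] by (simp add: D_def)
  ultimately show thesis
    using that[of D] by (auto simp: D_def)
qed

text \<open>Both suprema in the norm are nonnegative, so each is at most their sum.\<close>

lemma holder_dist_bounds:
  assumes "f \<in> holder_space \<alpha>" "g \<in> holder_space \<alpha>" "0 < \<alpha>"
  shows "x \<in> {0..1} \<Longrightarrow> \<bar>f x - g x\<bar> \<le> holder_dist \<alpha> f g"
    and "x \<in> {0..1} \<Longrightarrow> y \<in> {0..1} \<Longrightarrow>
      \<bar>(f x - g x) - (f y - g y)\<bar> \<le> holder_dist \<alpha> f g * \<bar>x - y\<bar> powr \<alpha>"
proof -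
  let ?P = "{(x, y). x \<in> {0..1} \<and> y \<in> {0..1} \<and> x \<noteq> (y::real)}"
  define A where "A = (SUP x\<in>{0..1}. \<bar>f x - g x\<bar>)"
  define H where "H = (SUP (x, y)\<in>?P. \<bar>(f x - g x) - (f y - g y)\<bar> / \<bar>x - y\<bar> powr \<alpha>)"
  have d: "holder_dist \<alpha> f g = A + H"
    using assms by (simp add: holder_dist_def holder_norm_def A_def H_def)
  have A: "\<bar>f x - g x\<bar> \<le> A" if "x \<in> {0..1}" for x
    unfolding A_def using that holder_bounded(1)[OF assms] by (rule cSUP_upper)
  have H: "\<bar>(f x - g x) - (f y - g y)\<bar> / \<bar>x - y\<bar> powr \<alpha> \<le> H"
    if "x \<in> {0..1}" "y \<in> {0..1}" "x \<noteq> y" for x y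
    using cSUP_upper[OF _ holder_bounded(2)[OF assms], of "(x, y)"] that by (simp add: H_def)
  have A0: "0 \<le> A"
    using A[of 0] by simp
  have H0: "0 \<le> H"
    using H[of 0 1] by (rule order_trans[rotated]) auto
  show "\<bar>f x - g x\<bar> \<le> holder_dist \<alpha> f g" if "x \<in> {0..1}"
    using A[OF that] H0 d by simp
  show "\<bar>(f x - g x) - (f y - g y)\<bar> \<le> holder_dist \<alpha> f g * \<bar>x - y\<bar> powr \<alpha>"
    if xy: "x \<in> {0..1}" "y \<in> {0..1}"
  proof (cases "x = y")
    case False
    then have "\<bar>(f x - g x) - (f y - g y)\<bar> \<le> H * \<bar>x - y\<bar> powr \<alpha>"
      using H[OF xy] by (simp add: pos_divide_le_eq)
    also have "\<dots> \<le> holder_dist \<alpha> f g * \<bar>x - y\<bar> powr \<alpha>"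
      using A0 d by (intro mult_right_mono) auto
    finally show ?thesis .
  qed simp
qed

lemma holder_dist_le:
  assumes "f \<in> holder_space \<alpha>" "g \<in> holder_space \<alpha>"
    and "\<And>x. x \<in> {0..1} \<Longrightarrow> \<bar>f x - g x\<bar> \<le> A"
    and "\<And>x y. x \<in> {0..1} \<Longrightarrow> y \<in> {0..1} \<Longrightarrow> \<bar>(f x - g x) - (f y - g y)\<bar> \<le> H * \<bar>x - y\<bar> powr \<alpha>"
  shows "holder_dist \<alpha> f g \<le> A + H"
proof -
  let ?P = "{(x, y). x \<in> {0..1} \<and> y \<in> {0..1} \<and> x \<noteq> (y::real)}"
  have "(0, 1) \<in> ?P"
    by simp
  then have ne: "?P \<noteq> {}"
    by (metis empty_iff)
  have "(SUP x\<in>{0..1}. \<bar>f x - g x\<bar>) \<le> A"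
    using assms(3) by (intro cSUP_least) auto
  moreover have "(SUP (x, y)\<in>?P. \<bar>(f x - g x) - (f y - g y)\<bar> / \<bar>x - y\<bar> powr \<alpha>) \<le> H"
    using assms(4) by (intro cSUP_least[OF ne]) (auto simp: pos_divide_le_eq)
  ultimately show ?thesis
    using assms(1,2) by (simp add: holder_dist_def holder_norm_def)
qed

text \<open>\<open>restrict\<close> returns to the extensional representatives that make up
  \<open>holder_space \<alpha>\<close>.\<close>

lemma holder_space_add_mult:
  assumes "f \<in> holder_space \<alpha>" "g \<in> holder_space \<alpha>" "0 < \<alpha>"
  shows "restrict (\<lambda>x. f x + t * g x) {0..1} \<in> holder_space \<alpha>"
proof -
  obtain C where C: "\<And>x y. x \<in> {0..1} \<Longrightarrow> y \<in> {0..1} \<Longrightarrow> \<bar>f x - f y\<bar> \<le> C * \<bar>x - y\<bar> powr \<alpha>"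
    using holder_space_estimates[OF assms(1,3)] by metis
  obtain D where D: "\<And>x y. x \<in> {0..1} \<Longrightarrow> y \<in> {0..1} \<Longrightarrow> \<bar>g x - g y\<bar> \<le> D * \<bar>x - y\<bar> powr \<alpha>"
    using holder_space_estimates[OF assms(2,3)] by metis
  have "\<bar>(f x + t * g x) - (f y + t * g y)\<bar> \<le> (C + \<bar>t\<bar> * D) * \<bar>x - y\<bar> powr \<alpha>"
    if "x \<in> {0..1}" "y \<in> {0..1}" for x y
  proof -
    have "\<bar>(f x + t * g x) - (f y + t * g y)\<bar> = \<bar>(f x - f y) + t * (g x - g y)\<bar>"
      by (simp add: algebra_simps)
    also have "\<dots> \<le> \<bar>f x - f y\<bar> + \<bar>t\<bar> * \<bar>g x - g y\<bar>"
      by (metis abs_mult abs_triangle_ineq)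
    also have "\<dots> \<le> C * \<bar>x - y\<bar> powr \<alpha> + \<bar>t\<bar> * (D * \<bar>x - y\<bar> powr \<alpha>)"
      using C[OF that] D[OF that] by (intro add_mono mult_left_mono) auto
    finally show ?thesis
      by (simp add: algebra_simps)
  qed
  then show ?thesis
    unfolding holder_space_def by (intro CollectI conjI exI[of _ "C + \<bar>t\<bar> * D"]) auto
qed

lemma holder_perturbation:
  assumes "f \<in> holder_space \<alpha>" "g \<in> holder_space \<alpha>" "0 < \<alpha>" "0 < r"
  obtains e where "0 < e"
    "\<And>t. \<bar>t\<bar> \<le> e \<Longrightarrow> holder_dist \<alpha> f (restrict (\<lambda>x. f x + t * g x) {0..1}) < r"
proof -
  obtain D where D: "0 < D" "\<And>x. x \<in> {0..1} \<Longrightarrow> \<bar>g x\<bar> \<le> D"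
    "\<And>x y. x \<in> {0..1} \<Longrightarrow> y \<in> {0..1} \<Longrightarrow> \<bar>g x - g y\<bar> \<le> D * \<bar>x - y\<bar> powr \<alpha>"
    using holder_space_estimates[OF assms(2,3)] by metis
  \<comment> \<open>Each of the two parts of the norm is then at most
    \<open>e * D = r / 4\<close>.\<close>
  define e where "e = r / (4 * D)"
  have "holder_dist \<alpha> f (restrict (\<lambda>x. f x + t * g x) {0..1}) < r" if t: "\<bar>t\<bar> \<le> e" for t
  proof -
    have "holder_dist \<alpha> f (restrict (\<lambda>x. f x + t * g x) {0..1}) \<le> e * D + e * D"
    proof (rule holder_dist_le[OF assms(1) holder_space_add_mult[OF assms(1,2,3)]])
      fix x y :: real assume x: "x \<in> {0..1}"
      have "\<bar>t\<bar> * \<bar>g x\<bar> \<le> e * D"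
        using t D(2)[OF x] by (intro mult_mono) auto
      then show "\<bar>f x - restrict (\<lambda>x. f x + t * g x) {0..1} x\<bar> \<le> e * D"
        using x by (simp add: abs_mult)
      assume y: "y \<in> {0..1}"
      have "\<bar>t\<bar> * \<bar>g x - g y\<bar> \<le> e * (D * \<bar>x - y\<bar> powr \<alpha>)"
        using t D(3)[OF x y] by (intro mult_mono) auto
      moreover have "- (t * g x) + t * g y = - t * (g x - g y)"
        by (simp add: algebra_simps)
      ultimately show "\<bar>f x - restrict (\<lambda>x. f x + t * g x) {0..1} x
          - (f y - restrict (\<lambda>x. f x + t * g x) {0..1} y)\<bar> \<le> e * D * \<bar>x - y\<bar> powr \<alpha>"
        using x y by (simp add: abs_mult mult.assoc)
    qed
    also have "\<dots> < r"
      using D(1) assms(4) by (simp add: e_def)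
    finally show ?thesis .
  qed
  then show thesis
    using that[of e] D(1) assms(4) by (simp add: e_def)
qed

text \<open>Distances in [0,1] are at most 1, so they are bounded by their powers with exponent
  \<alpha> \<le> 1.\<close>

lemma lipschitz_holder_space:
  fixes f :: "real \<Rightarrow> real"
  assumes "\<And>x y. \<bar>f x - f y\<bar> \<le> L * \<bar>x - y\<bar>" "0 \<le> L" "0 < \<alpha>" "\<alpha> \<le> 1"
  shows "restrict f {0..1} \<in> holder_space \<alpha>"
proof -
  have "\<bar>f x - f y\<bar> \<le> L * \<bar>x - y\<bar> powr \<alpha>" if "x \<in> {0..1}" "y \<in> {0..1}" for x y
  proof -
    have "\<bar>x - y\<bar> powr 1 \<le> \<bar>x - y\<bar> powr \<alpha>"
      using that assms by (intro powr_mono') auto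
    then have "L * \<bar>x - y\<bar> \<le> L * \<bar>x - y\<bar> powr \<alpha>"
      using assms(2) by (intro mult_left_mono) auto
    then show ?thesis
      using assms(1)[of x y] by linarith
  qed
  then show ?thesis
    unfolding holder_space_def by (intro CollectI conjI exI[of _ L]) auto
qed

section \<open>Uniqueness and stability of the maximizing measure\<close>

text \<open>Lipschitz ramps converge to the indicators of the half-lines \<open>{..c}\<close>, so
  the integrals of Hoelder functions determine the distribution function. Measures are pushed
  forward to the real line because distribution functions live there.\<close>

lemma unit_measure_eqI:
  assumes \<mu>: "\<mu> \<in> space (prob_algebra unit_borel)" and \<nu>: "\<nu> \<in> space (prob_algebra unit_borel)"
    and \<alpha>: "0 < \<alpha>" "\<alpha> \<le> 1"
    and eq: "\<And>f. f \<in> holder_space \<alpha> \<Longrightarrow> integral\<^sup>L \<mu> f = integral\<^sup>L \<nu> f"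
  shows "\<mu> = \<nu>"
proof -
  have id: "(\<lambda>x. x) \<in> borel_measurable \<kappa>" if "\<kappa> \<in> space (prob_algebra unit_borel)" for \<kappa>
    unfolding measurable_cong_sets[OF prob_unit_borelD(2)[OF that] refl]
    by (intro measurable_restrict_space1) simp
  \<comment> \<open>For positive \<open>m\<close>, the ramp that is 1 up to \<open>c\<close> and
    falls with slope \<open>- real m\<close> to 0 at \<open>c + 1 / m\<close>.\<close>
  define f where "f m c x = max 0 (min 1 (1 - real m * (x - c)))" for m c x
  have lim: "(\<lambda>m. \<integral>x. f m c x \<partial>\<kappa>) \<longlonglongrightarrow> cdf (distr \<kappa> borel (\<lambda>x. x)) c"
    if \<kappa>: "\<kappa> \<in> space (prob_algebra unit_borel)" for \<kappa> c
  proof -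
    interpret prob_space \<kappa>
      using prob_unit_borelD[OF \<kappa>] by simp
    have "(\<lambda>m. f m c x) \<longlonglongrightarrow> indicator {..c} x" for x
    proof (cases "x \<le> c")
      case True
      then have "f m c x = 1" for m
        using mult_nonneg_nonpos[of "real m" "x - c"] by (simp add: f_def)
      then show ?thesis
        using True by simp
    next
      case False
      obtain m0 :: nat where m0: "1 < real m0 * (x - c)"
        using ex_less_of_nat_mult[of "x - c" 1] False by auto
      have "f m c x = 0" if "m0 \<le> m" for m
      proof -
        have "real m0 * (x - c) \<le> real m * (x - c)"
          using that False by (intro mult_right_mono) auto
        then show ?thesis
          using m0 by (simp add: f_def)
      qed
      then have "\<forall>\<^sub>F m in sequentially. f m c x = 0"
        unfolding eventually_sequentially by blast
      then show ?thesis
        using False by (simp add: tendsto_eventually)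
    qed
    moreover have "(\<lambda>x. f m c x) \<in> borel_measurable \<kappa>" for m
      unfolding f_def using id[OF \<kappa>] by measurable
    moreover have "indicat_real {..c} \<in> borel_measurable \<kappa>"
      using measurable_compose[OF id[OF \<kappa>], of "indicator {..c}" borel] by simp
    ultimately have "(\<lambda>m. \<integral>x. f m c x \<partial>\<kappa>) \<longlonglongrightarrow> (\<integral>x. indicat_real {..c} x \<partial>\<kappa>)"
      by (intro integral_dominated_convergence[where w = "\<lambda>_. 1"]) (auto simp: f_def)
    also have "(\<integral>x. indicat_real {..c} x \<partial>\<kappa>) = (\<integral>x. indicat_real {..c} x \<partial>distr \<kappa> borel (\<lambda>x. x))"
      by (rule integral_distr[OF id[OF \<kappa>], symmetric]) simp
    also have "\<dots> = cdf (distr \<kappa> borel (\<lambda>x. x)) c"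
      by (simp add: cdf_def)
    finally show ?thesis .
  qed
  have ints: "(\<integral>x. f m c x \<partial>\<mu>) = (\<integral>x. f m c x \<partial>\<nu>)" for m c
  proof -
    have "\<bar>f m c x - f m c y\<bar> \<le> real m * \<bar>x - y\<bar>" for x y
    proof -
      have "\<bar>f m c x - f m c y\<bar> \<le> \<bar>real m * (x - y)\<bar>"
        unfolding f_def right_diff_distrib by linarith
      then show ?thesis
        by (simp add: abs_mult)
    qed
    then have "restrict (f m c) {0..1} \<in> holder_space \<alpha>"
      using \<alpha> by (intro lipschitz_holder_space) auto
    from eq[OF this] show ?thesis
      using integral_unit_cong[OF \<mu>, of "f m c" "restrict (f m c) {0..1}"]
        integral_unit_cong[OF \<nu>, of "f m c" "restrict (f m c) {0..1}"] by simp
  qed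
  have rd: "real_distribution (distr \<kappa> borel (\<lambda>x. x))" if "\<kappa> \<in> space (prob_algebra unit_borel)" for \<kappa>
    using prob_space.real_distribution_distr[OF prob_unit_borelD(1)[OF that] id[OF that]] .
  have "cdf (distr \<mu> borel (\<lambda>x. x)) = cdf (distr \<nu> borel (\<lambda>x. x))"
  proof
    fix c
    show "cdf (distr \<mu> borel (\<lambda>x. x)) c = cdf (distr \<nu> borel (\<lambda>x. x)) c"
      using LIMSEQ_unique[OF lim[OF \<mu>, of c]] lim[OF \<nu>, of c] unfolding ints by blast
  qed
  then have distr: "distr \<mu> borel (\<lambda>x. x) = distr \<nu> borel (\<lambda>x. x)"
    using rd \<mu> \<nu> by (intro cdf_unique)
  show ?thesis
  proof (rule measure_eqI)
    show "sets \<mu> = sets \<nu>"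
      using prob_unit_borelD(2)[OF \<mu>] prob_unit_borelD(2)[OF \<nu>] by simp
    fix A assume "A \<in> sets \<mu>"
    then have A: "A \<in> sets borel" "A \<subseteq> {0..1}"
      using prob_unit_borelD(2)[OF \<mu>] by (auto simp: sets_restrict_space_iff)
    \<comment> \<open>The push-forward along the inclusion keeps the mass of every Borel subset of
      [0,1], so equality on the line gives equality on the interval.\<close>
    have "emeasure (distr \<kappa> borel (\<lambda>x. x)) A = emeasure \<kappa> A" if "\<kappa> \<in> space (prob_algebra unit_borel)" for \<kappa>
      using emeasure_distr[OF id[OF that] A(1)] prob_unit_borelD(3)[OF that] A(2) by (simp add: Int_absorb2)
    then show "emeasure \<mu> A = emeasure \<nu> A"
      using distr \<mu> \<nu> by metis
  qed
qed

text \<open>The two measures agree on \<phi>, and \<open>\<mu>\<close> still maximizes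
  \<open>\<phi> + t * f\<close> for small \<open>t\<close>. Comparing integrals leaves
  \<open>t\<close> times the integrals of \<open>f\<close>; the two signs of \<open>t\<close> give
  opposite inequalities.\<close>

lemma limit_maximizing_unique:
  assumes \<alpha>: "0 < \<alpha>" "\<alpha> \<le> 1" and \<phi>: "\<phi> \<in> holder_space \<alpha>" and r: "0 < r"
    and max: "\<And>\<psi>. \<psi> \<in> holder_space \<alpha> \<Longrightarrow> holder_dist \<alpha> \<phi> \<psi> < r \<Longrightarrow> limit_maximizing \<psi> \<mu>"
    and \<nu>: "limit_maximizing \<phi> \<nu>"
  shows "\<nu> = \<mu>"
proof -
  have "holder_dist \<alpha> \<phi> \<phi> = 0"
    using Metric_space.mdist_zero[OF Metric_space_holder[OF \<alpha>(1)] \<phi>] .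
  then have \<mu>: "limit_maximizing \<phi> \<mu>"
    using max[OF \<phi>] r by simp
  then have lim: "\<mu> \<in> limit_measures" "\<nu> \<in> limit_measures" and eq: "integral\<^sup>L \<nu> \<phi> = integral\<^sup>L \<mu> \<phi>"
    using \<nu> by (auto simp: limit_maximizing_def)
  note prob = limit_measures_prob[OF lim(1)] limit_measures_prob[OF lim(2)]
  show ?thesis
  proof (rule unit_measure_eqI[OF prob(2,1) \<alpha>])
    fix f assume f: "f \<in> holder_space \<alpha>"
    obtain e where e: "0 < e"
      "\<And>t. \<bar>t\<bar> \<le> e \<Longrightarrow> holder_dist \<alpha> \<phi> (restrict (\<lambda>x. \<phi> x + t * f x) {0..1}) < r"
      using holder_perturbation[OF \<phi> f \<alpha>(1) r] by blast
    have le: "t * integral\<^sup>L \<nu> f \<le> t * integral\<^sup>L \<mu> f" if "\<bar>t\<bar> \<le> e" for t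
    proof -
      let ?\<psi> = "restrict (\<lambda>x. \<phi> x + t * f x) {0..1}"
      note \<psi> = holder_space_add_mult[OF \<phi> f \<alpha>(1), of t]
      have int: "integral\<^sup>L \<kappa> ?\<psi> = integral\<^sup>L \<kappa> \<phi> + t * integral\<^sup>L \<kappa> f"
        if \<kappa>: "\<kappa> \<in> space (prob_algebra unit_borel)" for \<kappa>
      proof -
        have "integral\<^sup>L \<kappa> ?\<psi> = (\<integral>x. \<phi> x + t * f x \<partial>\<kappa>)"
          by (rule integral_unit_cong[OF \<kappa>]) simp
        then show ?thesis
          using integrable_unit_continuous[OF \<kappa>] holder_space_continuous[OF _ \<alpha>(1)] \<phi> f by simp
      qed
      have "integral\<^sup>L \<nu> ?\<psi> \<le> max_integral ?\<psi>"
        by (rule integral_le_max_integral[OF lim(2) holder_space_continuous[OF \<psi> \<alpha>(1)]])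
      also have "\<dots> = integral\<^sup>L \<mu> ?\<psi>"
        using max[OF \<psi> e(2)[OF that]] by (simp add: limit_maximizing_def)
      finally show ?thesis
        using int[OF prob(1)] int[OF prob(2)] eq by simp
    qed
    show "integral\<^sup>L \<nu> f = integral\<^sup>L \<mu> f"
      using le[of e] le[of "- e"] e(1) by simp
  qed
qed

text \<open>Take \<open>\<phi>' = \<phi> - e * g\<close>. A function within
  \<open>e * \<delta>\<close> of it has the form \<open>\<phi> - e * (g + h)\<close> with
  \<open>h\<close> of norm less than \<delta>; the FCF measure maximizes the first term and
  minimizes \<open>g + h\<close>, hence it maximizes the difference.\<close>

lemma limit_maximizing_stable_perturbation:
  assumes \<alpha>: "0 < \<alpha>" "\<alpha> \<le> 1" and \<phi>: "\<phi> \<in> holder_space \<alpha>" and r: "0 < r"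
    and as: "\<forall>a\<in>set as. 1 \<le> a" and max: "limit_maximizing \<phi> (fcf_measure as)"
  obtains \<phi>' s where "\<phi>' \<in> holder_space \<alpha>" "holder_dist \<alpha> \<phi> \<phi>' < r" "0 < s"
    "\<And>\<psi>. \<psi> \<in> holder_space \<alpha> \<Longrightarrow> holder_dist \<alpha> \<phi>' \<psi> < s \<Longrightarrow> limit_maximizing \<psi> (fcf_measure as)"
proof -
  let ?\<mu> = "fcf_measure as"
  obtain g \<delta> where g: "g \<in> holder_space \<alpha>" "0 < \<delta>"
    and min: "\<And>h \<nu>. \<nu> \<in> invariant_measures \<Longrightarrow> (\<And>x. x \<in> {0..1} \<Longrightarrow> \<bar>h x\<bar> \<le> \<delta>) \<Longrightarrow>
      (\<And>x y. x \<in> {0..1} \<Longrightarrow> y \<in> {0..1} \<Longrightarrow> \<bar>h x - h y\<bar> \<le> \<delta> * \<bar>x - y\<bar> powr \<alpha>) \<Longrightarrow>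
      (\<integral>x. g x + h x \<partial>?\<mu>) \<le> (\<integral>x. g x + h x \<partial>\<nu>)"
    using fcf_robust_minimum[OF as \<alpha>] by blast
  obtain e where e: "0 < e"
    "\<And>t. \<bar>t\<bar> \<le> e \<Longrightarrow> holder_dist \<alpha> \<phi> (restrict (\<lambda>x. \<phi> x + t * g x) {0..1}) < r"
    using holder_perturbation[OF \<phi> g(1) \<alpha>(1) r] by blast
  define \<phi>' where "\<phi>' = restrict (\<lambda>x. \<phi> x + (- e) * g x) {0..1}"
  have \<phi>': "\<phi>' \<in> holder_space \<alpha>"
    unfolding \<phi>'_def by (rule holder_space_add_mult[OF \<phi> g(1) \<alpha>(1)])
  have lim: "?\<mu> \<in> limit_measures"
    using max by (simp add: limit_maximizing_def)
  have "limit_maximizing \<psi> ?\<mu>" if \<psi>: "\<psi> \<in> holder_space \<alpha>" and d: "holder_dist \<alpha> \<phi>' \<psi> < e * \<delta>" for \<psi>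
  proof (rule limit_maximizingI[OF lim holder_space_continuous[OF \<psi> \<alpha>(1)]])
    fix \<nu> assume \<nu>: "\<nu> \<in> invariant_measures"
    \<comment> \<open>The solution of \<open>\<psi> = \<phi> - e * (g + h)\<close> on [0,1].\<close>
    define h where "h x = (\<phi>' x - \<psi> x) / e" for x
    have h1: "\<bar>h x\<bar> \<le> \<delta>" if "x \<in> {0..1}" for x
      using holder_dist_bounds(1)[OF \<phi>' \<psi> \<alpha>(1) that] d e(1) by (simp add: h_def pos_divide_le_eq mult.commute)
    have h2: "\<bar>h x - h y\<bar> \<le> \<delta> * \<bar>x - y\<bar> powr \<alpha>" if "x \<in> {0..1}" "y \<in> {0..1}" for x y
    proof -
      have "\<bar>(\<phi>' x - \<psi> x) - (\<phi>' y - \<psi> y)\<bar> \<le> holder_dist \<alpha> \<phi>' \<psi> * \<bar>x - y\<bar> powr \<alpha>"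
        by (rule holder_dist_bounds(2)[OF \<phi>' \<psi> \<alpha>(1) that])
      also have "\<dots> \<le> e * \<delta> * \<bar>x - y\<bar> powr \<alpha>"
        using d by (intro mult_right_mono) auto
      finally show ?thesis
        using e(1) by (simp add: h_def pos_divide_le_eq mult.commute mult.left_commute flip: diff_divide_distrib)
    qed
    have int: "integral\<^sup>L \<kappa> \<psi> = integral\<^sup>L \<kappa> \<phi> - e * (\<integral>x. g x + h x \<partial>\<kappa>)"
      if \<kappa>: "\<kappa> \<in> space (prob_algebra unit_borel)" for \<kappa>
    proof -
      have cont: "continuous_on {0..1} (\<lambda>x. g x + h x)"
        using holder_space_continuous[OF g(1) \<alpha>(1)] holder_estimate_continuous[OF \<alpha>(1) h2]
        by (intro continuous_on_add)
      have "integral\<^sup>L \<kappa> \<psi> = (\<integral>x. \<phi> x - e * (g x + h x) \<partial>\<kappa>)"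
        by (rule integral_unit_cong[OF \<kappa>]) (use e(1) in \<open>simp add: h_def \<phi>'_def field_simps\<close>)
      then show ?thesis
        using integrable_unit_continuous[OF \<kappa> cont] 
          integrable_unit_continuous[OF \<kappa> holder_space_continuous[OF \<phi> \<alpha>(1)]] 
        by (simp del: Bochner_Integration.integral_add)
    qed
    have "\<nu> \<in> limit_measures"
      unfolding limit_measures_def using \<nu> closure_of_subset[of invariant_measures weak_star_topology]
        invariant_measuresD(1) topspace_weak_star by blast
    then have "integral\<^sup>L \<nu> \<phi> \<le> integral\<^sup>L ?\<mu> \<phi>"
      using max integral_le_max_integral[OF _ holder_space_continuous[OF \<phi> \<alpha>(1)]]
      by (simp add: limit_maximizing_def)
    moreover have "e * (\<integral>x. g x + h x \<partial>?\<mu>) \<le> e * (\<integral>x. g x + h x \<partial>\<nu>)"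
      using min[OF \<nu> h1 h2] e(1) by simp
    ultimately show "integral\<^sup>L \<nu> \<psi> \<le> integral\<^sup>L ?\<mu> \<psi>"
      using int[OF invariant_measuresD(1)[OF \<nu>]] int[OF limit_measures_prob[OF lim]] by simp
  qed
  moreover have "holder_dist \<alpha> \<phi> \<phi>' < r"
    unfolding \<phi>'_def using e by (intro e(2)) simp
  ultimately show thesis
    using that[OF \<phi>', of "e * \<delta>"] e(1) g(2) by simp
qed

section \<open>Openness, density and finite optimization\<close>

theorem theorem4:
  fixes \<alpha> :: real
  assumes "0 < \<alpha>" and "\<alpha> \<le> 1"
  shows "\<exists>U. openin (holder_topology \<alpha>) U
           \<and> (\<forall>\<phi>\<in>U. finite_optimization_property \<phi>)
           \<and> U \<subseteq> rationally_maximized \<alpha>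
           \<and> subtopology (holder_topology \<alpha>) (rationally_maximized \<alpha>) closure_of U
               = rationally_maximized \<alpha>"
proof -
  interpret Metric_space "holder_space \<alpha>" "holder_dist \<alpha>"
    by (rule Metric_space_holder[OF assms(1)])
  define stable where "stable as \<phi> r \<longleftrightarrow> (\<forall>a\<in>set as. 1 \<le> a) \<and> 0 < r \<and>
    (\<forall>\<psi>\<in>mball \<phi> r. limit_maximizing \<psi> (fcf_measure as))" for as \<phi> r
  \<comment> \<open>The union over all words of the interiors of the sets of functions that the FCF
    measure of the word limit-maximizes. The rationally maximized functions are the union of these
    sets themselves, so density means that each set lies in the closure of \<open>U\<close>.\<close>
  define U where "U = {\<phi> \<in> holder_space \<alpha>. \<exists>as r. stable as \<phi> r}"
  have max: "limit_maximizing \<phi> (fcf_measure as)" if "\<phi> \<in> holder_space \<alpha>" "stable as \<phi> r" for \<phi> as r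
    using that by (auto simp: stable_def)
  \<comment> \<open>The empty word stands for the Dirac measure at 0, which merges the two
    alternatives.\<close>
  have R: "rationally_maximized \<alpha> =
      {\<phi> \<in> holder_space \<alpha>. \<exists>as. (\<forall>a\<in>set as. 1 \<le> a) \<and> limit_maximizing \<phi> (fcf_measure as)}"
  proof -
    have "limit_maximizing \<phi> (return unit_borel 0) \<or>
        (\<exists>as. as \<noteq> [] \<and> (\<forall>a\<in>set as. 1 \<le> a) \<and> limit_maximizing \<phi> (fcf_measure as)) \<longleftrightarrow>
        (\<exists>as. (\<forall>a\<in>set as. 1 \<le> a) \<and> limit_maximizing \<phi> (fcf_measure as))" for \<phi>
      using fcf_measure_Nil by (metis empty_iff list.set(1))
    then show ?thesis
      unfolding rationally_maximized_def by presburger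
  qed
  have sub: "U \<subseteq> rationally_maximized \<alpha>"
  proof
    fix \<phi> assume "\<phi> \<in> U"
    then obtain as r where "\<phi> \<in> holder_space \<alpha>" "stable as \<phi> r"
      by (auto simp: U_def)
    then show "\<phi> \<in> rationally_maximized \<alpha>"
      using max unfolding R stable_def by blast
  qed
  have "openin mtopology U"
    unfolding openin_mtopology
  proof (intro conjI allI impI)
    show "U \<subseteq> holder_space \<alpha>"
      by (auto simp: U_def)
    fix \<phi> assume "\<phi> \<in> U"
    then obtain as r where \<phi>: "\<phi> \<in> holder_space \<alpha>" and st: "stable as \<phi> r"
      by (auto simp: U_def)
    have "\<psi> \<in> U" if \<psi>: "\<psi> \<in> mball \<phi> r" for \<psi>
    proof -
      obtain s where "0 < s" "mball \<psi> s \<subseteq> mball \<phi> r"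
        using openin_mball[of \<phi> r] \<psi> unfolding openin_mtopology by blast
      then have "stable as \<psi> s"
        using st unfolding stable_def by blast
      then show ?thesis
        using \<psi> by (auto simp: U_def)
    qed
    moreover have "0 < r"
      using st by (simp add: stable_def)
    ultimately show "\<exists>r>0. mball \<phi> r \<subseteq> U"
      by blast
  qed
  moreover have "finite_optimization_property \<phi>" if \<phi>U: "\<phi> \<in> U" for \<phi>
  proof -
    obtain as r where \<phi>: "\<phi> \<in> holder_space \<alpha>" and st: "stable as \<phi> r"
      using \<phi>U by (auto simp: U_def)
    then have as: "\<forall>a\<in>set as. 1 \<le> a" "0 < r"
      by (auto simp: stable_def)
    have uniq: "\<nu> = fcf_measure as" if "limit_maximizing \<phi> \<nu>" for \<nu>
      using st \<phi> that
      by (intro limit_maximizing_unique[OF assms \<phi> as(2)]) (auto simp: stable_def)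
    have m: "limit_maximizing \<phi> (fcf_measure as)"
      by (rule max[OF \<phi> st])
    then have "fcf_measure as \<in> limit_measures"
      by (simp add: limit_maximizing_def)
    then show ?thesis
      unfolding finite_optimization_property_def
      by (intro bexI[of _ "fcf_measure as"] conjI allI impI finitely_supported_fcf_measure[OF as(1)] m uniq)
  qed
  moreover have "subtopology mtopology (rationally_maximized \<alpha>) closure_of U = rationally_maximized \<alpha>"
  proof -
    have "\<exists>\<psi>\<in>U. \<psi> \<in> mball \<phi> r" if \<phi>: "\<phi> \<in> rationally_maximized \<alpha>" and r: "0 < r" for \<phi> r
    proof -
      obtain as where as: "\<forall>a\<in>set as. 1 \<le> a" "limit_maximizing \<phi> (fcf_measure as)" and H: "\<phi> \<in> holder_space \<alpha>"
        using \<phi> unfolding R by blast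
      obtain \<psi> s where \<psi>: "\<psi> \<in> holder_space \<alpha>" "holder_dist \<alpha> \<phi> \<psi> < r" "0 < s"
        "\<And>\<xi>. \<xi> \<in> holder_space \<alpha> \<Longrightarrow> holder_dist \<alpha> \<psi> \<xi> < s \<Longrightarrow> limit_maximizing \<xi> (fcf_measure as)"
        using limit_maximizing_stable_perturbation[OF assms H r as] by blast
      then have "stable as \<psi> s"
        using as(1) by (auto simp: stable_def)
      then show ?thesis
        using \<psi> H by (auto simp: U_def)
    qed
    \<comment> \<open>Density is shown in the whole Hoelder space; the closure in the subspace is
      the trace of this closure, as \<open>U\<close> lies in the subspace.\<close>
    then have "rationally_maximized \<alpha> \<subseteq> mtopology closure_of U"
      unfolding metric_closure_of by (auto simp: rationally_maximized_def)
    then show ?thesis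
      using sub unfolding closure_of_subtopology by (auto simp: Int_absorb1)
  qed
  ultimately show ?thesis
    using sub unfolding holder_topology_def by blast
qed

end
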